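(* Let $n\ge2$ be an integer, let $M$ be one of the matrix spaces $M_\nu$ (with $\nu\in\mathbb{N}_0$ fixed), $H_1=\imath\,\mathrm{o}(2n)$, $H_1=\imath\,\mathrm{o}(2n+1)$, $H_4=\imath\,\mathrm{usp}(2n)$, with associated parameter $\nu$, and let $\tilde\omega\in L^1_{H_2}(\mathbb{R})$ be a P\'olya frequency function of order $n$ with $\tilde\omega\neq0$ and support contained in $[0,\infty)$. Then the function $$\omega(x)=\frac{1}{\Gamma(\nu+1)}\int_0^\infty\left(\frac xy\right)^\nu\exp\left[-\frac xy\right]\tilde\omega(y)\,\frac{dy}{y},\qquad x>0,$$ belongs to $L^1_M(\mathbb{R}_+)$ and gives rise to a P\'olya ensemble on $M$.
   Context: $\mathbb{R}_+=(0,\infty)$, $\Delta_n(a)=\prod_{1\le b<c\le n}(a_c-a_b)$. Matrix spaces. For $\nu\in\mathbb{N}_0$, $M_\nu$ is the space of complex $n\times(n+\nu)$ matrices $y$ (identified with the chiral Hermitian matrices $\begin{bmatrix}0&y\\ y^*&0\end{bmatrix}$), with $\mathrm{U}(n)\times\mathrm{U}(n+\nu)$ acting by $y\mapsto k_1yk_2^*$. $H_1=\imath\,\mathrm{o}(2n)$ or $\imath\,\mathrm{o}(2n+1)$ is the space of Hermitian anti-symmetric matrices and $H_4=\imath\,\mathrm{usp}(2n)$ the space of Hermitian anti-self-dual matrices, with $\mathrm{O}(2n)$, $\mathrm{O}(2n+1)$, $\mathrm{USp}(2n)$, respectively, acting by conjugation. The parameter $\nu$ is the given integer for $M_\nu$,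 $\nu=-\tfrac12$ for $\imath\,\mathrm{o}(2n)$, and $\nu=+\tfrac12$ for $\imath\,\mathrm{o}(2n+1)$ and $\imath\,\mathrm{usp}(2n)$. Almost every $y\in M$ has $n$ distinct squared singular values $a_1,\dots,a_n>0$, which are the squares of the non-zero eigenvalues $\pm\sqrt{a_1},\dots,\pm\sqrt{a_n}$ (of the chiral Hermitian matrix for $M_\nu$). Invariant probability densities on $M$ (with respect to Lebesgue measure on the independent real entries) are in bijection with symmetric probability densities on $\mathbb{R}_+^n$ via the induced joint density of $a_1,\dots,a_n$. For $\mathcal N\in\{\mathbb{R},\mathbb{R}_+\}$, $L^1_{[1,n]}(\mathcal N)$ is the set of $f\in L^1(\mathcal N)$ with $\int_{\mathcal N}|x|^{\kappa-1}|f(x)|dx<\infty$ for all $\kappa\in[1,n]$. $L^1_{H_2}(\mathbb{R})$: the set of $f\in L^1(\mathbb{R})$ that are non-negative, $(n-1)$-times differentiable, with $\frac{\partial^jf}{\partial x^j}\in L^1_{[1,n]}(\mathbb{R})$ for $j=0,\dots,n-1$. $L^1_M(\mathbb{R}_+)$: the set of $f\in L^1(\mathbb{R}_+)$ which are non-negative and $2(n-1)$-times differentiable, with $\big(x^\nu\frac{\partial}{\partial x}\frac1{x^{\nu-1}}\frac{\partial}{\partial x}\big)^jf\in L^1_{[1,n]}(\mathbb{R}_+)$ for $j=0,\dots,n-1$ and $\lim_{x\to0}x^{\nu+1}\frac{\partial}{\partial x}\frac1{x^\nu}\big(\frac{\partial}{\partial x}x^{\nu+1}\frac{\partial}{\partial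 x}\frac1{x^\nu}\big)^lf(x)=0$ for $l=0,\dots,n-2$. P\'olya ensemble on $M$ with weight $\omega\in L^1_M(\mathbb{R}_+)$: a probability measure on $M$ with invariant density whose induced symmetrized joint density of the squared singular values is $p(a)=C\,\Delta_n(a)\det[w_b(a_c)]_{b,c=1}^n\ge0$, $a\in\mathbb{R}_+^n$, with $w_j(x)=\big(x^\nu\frac{\partial}{\partial x}\frac1{x^{\nu-1}}\frac{\partial}{\partial x}\big)^{j-1}\omega(x)$ and normalization constant $C>0$. One says that $\omega$ gives rise to a P\'olya ensemble on $M$ if there is a constant $C>0$ such that this $p$ is a (non-negative) probability density. A measurable function $f:\mathbb{R}\to\mathbb{R}$ is a P\'olya frequency function of order $N\in\mathbb{N}$ if $\Delta_m(x)\Delta_m(y)\det[f(x_b-y_c)]_{b,c=1,\dots,m}\ge0$ for all $m=1,\dots,N$ and all $x,y\in\mathbb{R}^m$. *)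

theory Defs
  imports "Jordan_Normal_Form.Determinant" "HOL-Analysis.Analysis"
begin

text \<open>
  Points of the \<open>n\<close>-dimensional Euclidean space are functions on \<open>nat\<close> of which only the values at
  \<open>0, \<dots>, n - 1\<close> matter; all indices are shifted by one against the usual \<open>1, \<dots>, n\<close>.
  A function on the positive half-line is a function \<open>real \<Rightarrow> real\<close> of which only the values on
  \<open>{0<..}\<close> matter. That set is open, so \<open>deriv\<close> at its points depends on nothing else.
\<close>

text \<open>
  \<open>M_rect \<nu>\<close> stands for the complex \<open>n \<times> (n + \<nu>)\<close> matrices \<open>M\<^sub>\<nu>\<close>; \<open>M_io_even\<close>, \<open>M_io_odd\<close>, \<open>M_iusp\<close>
  stand for \<open>\<i> o(2n)\<close>, \<open>\<i> o(2n+1)\<close>, \<open>\<i> usp(2n)\<close>. Invariant probability densities on each of these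
  spaces are in bijection with symmetric probability densities of the squared singular values, and
  the weight space and the density below depend on the space only through \<open>n\<close> and the parameter
  \<open>\<nu>\<close>; hence only the kind of space is recorded.
\<close>

datatype matrix_space = M_rect nat | M_io_even | M_io_odd | M_iusp

fun space_param :: "matrix_space \<Rightarrow> real" where
  "space_param (M_rect \<nu>) = real \<nu>"
| "space_param M_io_even = - 1 / 2"
| "space_param M_io_odd = 1 / 2"
| "space_param M_iusp = 1 / 2"

definition times_differentiable_on :: "nat \<Rightarrow> (real \<Rightarrow> real) \<Rightarrow> real set \<Rightarrow> bool" where
  "times_differentiable_on k f S \<longleftrightarrow> (\<forall>j<k. (deriv ^^ j) f differentiable_on S)"

definition L1_moments :: "nat \<Rightarrow> real set \<Rightarrow> (real \<Rightarrow> real) set" where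
  "L1_moments n S = {f. set_integrable lborel S f \<and>
     (\<forall>\<kappa>\<in>{1..real n}. set_integrable lborel S (\<lambda>x. \<bar>x\<bar> powr (\<kappa> - 1) * \<bar>f x\<bar>))}"

definition L1_H2 :: "nat \<Rightarrow> (real \<Rightarrow> real) set" where
  "L1_H2 n = {f. set_integrable lborel UNIV f \<and> (\<forall>x. 0 \<le> f x) \<and>
     times_differentiable_on (n - 1) f UNIV \<and>
     (\<forall>j<n. (deriv ^^ j) f \<in> L1_moments n UNIV)}"

definition weight_op :: "real \<Rightarrow> (real \<Rightarrow> real) \<Rightarrow> real \<Rightarrow> real" where
  "weight_op \<nu> f = (\<lambda>x. x powr \<nu> * deriv (\<lambda>t. 1 / t powr (\<nu> - 1) * deriv f t) x)"

text \<open>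
  The boundary condition at the origin concerns \<open>x\<^bsup>\<nu>+1\<^esup> \<partial> x\<^bsup>-\<nu>\<^esup> (\<partial> x\<^bsup>\<nu>+1\<^esup> \<partial> x\<^bsup>-\<nu>\<^esup>)\<^sup>l f\<close>, a composition of
  operators in which each \<open>\<partial>\<close> acts on everything to its right.
\<close>

definition bdry_op :: "real \<Rightarrow> (real \<Rightarrow> real) \<Rightarrow> real \<Rightarrow> real" where
  "bdry_op \<nu> f = (\<lambda>x. x powr (\<nu> + 1) * deriv (\<lambda>t. 1 / t powr \<nu> * f t) x)"

definition L1_M :: "nat \<Rightarrow> matrix_space \<Rightarrow> (real \<Rightarrow> real) set" where
  "L1_M n M = (let \<nu> = space_param M in
     {f. set_integrable lborel {0<..} f \<and> (\<forall>x>0. 0 \<le> f x) \<and>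
       times_differentiable_on (2 * (n - 1)) f {0<..} \<and>
       (\<forall>j<n. (weight_op \<nu> ^^ j) f \<in> L1_moments n {0<..}) \<and>
       (\<forall>l<n - 1. ((bdry_op \<nu> (((\<lambda>g. deriv (bdry_op \<nu> g)) ^^ l) f)) \<longlongrightarrow> 0) (at_right 0))})"

definition vandermonde :: "nat \<Rightarrow> (nat \<Rightarrow> real) \<Rightarrow> real" where
  "vandermonde n a = (\<Prod>c<n. \<Prod>b<c. a c - a b)"

definition polya_density ::
  "nat \<Rightarrow> matrix_space \<Rightarrow> (real \<Rightarrow> real) \<Rightarrow> real \<Rightarrow> (nat \<Rightarrow> real) \<Rightarrow> real" where
  "polya_density n M \<omega> C a = C * vandermonde n a *
     Determinant.det (Matrix.mat n n (\<lambda>(b, c). (weight_op (space_param M) ^^ b) \<omega> (a c)))"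

text \<open>
  \<open>has_bochner_integral\<close> comprises measurability and integrability of the density with respect to
  the Lebesgue measure on \<open>{0<..}\<^sup>n\<close>.
\<close>

definition gives_rise_to_polya_ensemble :: "nat \<Rightarrow> matrix_space \<Rightarrow> (real \<Rightarrow> real) \<Rightarrow> bool" where
  "gives_rise_to_polya_ensemble n M \<omega> \<longleftrightarrow> (\<exists>C>0.
     (\<forall>a \<in> {..<n} \<rightarrow>\<^sub>E {0<..}. 0 \<le> polya_density n M \<omega> C a) \<and>
     has_bochner_integral (\<Pi>\<^sub>M i\<in>{..<n}. lborel)
       (\<lambda>a. indicator ({..<n} \<rightarrow>\<^sub>E {0<..}) a * polya_density n M \<omega> C a) 1)"

definition polya_frequency_function :: "nat \<Rightarrow> (real \<Rightarrow> real) \<Rightarrow> bool" where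
  "polya_frequency_function N f \<longleftrightarrow> f \<in> borel_measurable borel \<and>
     (\<forall>m\<in>{1..N}. \<forall>x y :: nat \<Rightarrow> real. 0 \<le> vandermonde m x * vandermonde m y *
        Determinant.det (Matrix.mat m m (\<lambda>(b, c). f (x b - y c))))"

end

theory Submission
  imports Defs
begin

text \<open>
  Let \<open>K(x, y) = x\<^sup>\<nu> y\<^sup>-\<^sup>\<nu>\<^sup>-\<^sup>1 exp(-x/y)\<close>. The operator \<open>x\<^sup>\<nu> \<partial>\<^sub>x x\<^sup>1\<^sup>-\<^sup>\<nu> \<partial>\<^sub>x = \<partial>\<^sub>x x\<^sup>\<nu>\<^sup>+\<^sup>1 \<partial>\<^sub>x x\<^sup>-\<^sup>\<nu>\<close> acts on \<open>K\<close> as \<open>\<partial>\<^sub>y\<close>,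
  so by partial integration it turns the mixture of \<open>w\<close> against \<open>K\<close> into minus the mixture of \<open>w'\<close>.
  Hence the weights are \<open>(-1)\<^sup>j\<close> times the mixtures of \<open>w\<^sup>(\<^sup>j\<^sup>)\<close>, and all integrability and boundary
  conditions reduce to those of \<open>w\<close>. By Andreief's identity, \<open>\<Delta>(a) det[w\<^sub>b(a\<^sub>c)]\<close> is an integral over
  \<open>y\<close> of \<open>\<Delta>(a) det[K(a\<^sub>c, y\<^sub>l)] det[(-1)\<^sup>j w\<^sup>(\<^sup>j\<^sup>)(y\<^sub>l)]\<close>. The first determinant has the sign of
  \<open>\<Delta>(a) \<Delta>(y)\<close> because exponential kernels are totally positive; the second one has the sign of
  \<open>\<Delta>(y)\<close>, as the limit of \<open>det[w(y\<^sub>l - c h)]\<close> for \<open>h \<rightarrow> 0\<close>. A second use of Andreief's identity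
  expresses the total mass by the moments \<open>\<integral> a\<^sup>i w\<^sub>j(a) da\<close>, which form a triangular matrix with
  positive diagonal.
\<close>

section \<open>Determinants of functions of two indices\<close>

text \<open>Entries are given by a function of two indices, so that determinants can be rewritten
  pointwise without dimension conditions.\<close>

abbreviation fun_det :: "nat \<Rightarrow> (nat \<Rightarrow> nat \<Rightarrow> real) \<Rightarrow> real" where
  "fun_det n f \<equiv> Determinant.det (Matrix.mat n n (\<lambda>(i, j). f i j))"

lemma permutes_less: "p permutes {0..<n} \<Longrightarrow> i < n \<Longrightarrow> p i < (n::nat)"
  using permutes_in_image[of p "{0..<n}" i] by simp

lemma fun_det_rows:
  "fun_det n f = (\<Sum>p | p permutes {0..<n}. signof p * (\<Prod>i<n. f i (p i)))"
  by (subst det_def'[where n = n]) (simp_all add: lessThan_atLeast0 permutes_less)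

lemma fun_det_cols:
  "fun_det n f = (\<Sum>p | p permutes {0..<n}. signof p * (\<Prod>j<n. f (p j) j))"
  by (subst det_col[where n = n]) (simp_all add: permutes_less)

lemma fun_det_cong:
  assumes "\<And>i j. i < n \<Longrightarrow> j < n \<Longrightarrow> f i j = g i j"
  shows "fun_det n f = fun_det n g"
  by (intro arg_cong[where f = Determinant.det]) (auto simp: assms)

lemma fun_det_transpose: "fun_det n (\<lambda>i j. f j i) = fun_det n f"
  unfolding fun_det_rows[of n "\<lambda>i j. f j i"] fun_det_cols[of n f] ..

text \<open>In each Leibniz term the row factors appear permuted, and their product is the same for
  every permutation.\<close>

lemma fun_det_scale: "fun_det n (\<lambda>i j. r i * c j * f i j) = (\<Prod>i<n. r i) * (\<Prod>j<n. c j) * fun_det n f"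
proof -
  have "(\<Prod>j<n. r (p j) * c j * f (p j) j) = (\<Prod>i<n. r i) * (\<Prod>j<n. c j) * (\<Prod>j<n. f (p j) j)"
    if "p permutes {0..<n}" for p
  proof -
    have "(\<Prod>j<n. r (p j)) = (\<Prod>i<n. r i)"
      using prod.permute[OF that, of r] by (simp add: lessThan_atLeast0 o_def)
    then show ?thesis by (simp add: prod.distrib)
  qed
  then show ?thesis
    unfolding fun_det_cols sum_distrib_left by (intro sum.cong refl) (simp add: mult_ac)
qed

lemma fun_det_scale_rows: "fun_det n (\<lambda>i j. r i * f i j) = (\<Prod>i<n. r i) * fun_det n f"
  using fun_det_scale[of n r "\<lambda>_. 1" f] by simp

lemma fun_det_scale_cols: "fun_det n (\<lambda>i j. c j * f i j) = (\<Prod>j<n. c j) * fun_det n f"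
  using fun_det_scale[of n "\<lambda>_. 1" c f] by simp

lemma fun_det_permute_rows:
  assumes "p permutes {0..<n}"
  shows "fun_det n (\<lambda>i j. f (p i) j) = signof p * fun_det n f"
proof -
  have "fun_det n (\<lambda>i j. f (p i) j) =
      Determinant.det (Matrix.mat n n (\<lambda>(i, j). Matrix.mat n n (\<lambda>(i, j). f i j) $$ (p i, j)))"
    using assms by (intro arg_cong[where f = Determinant.det]) (auto simp: permutes_less)
  also have "\<dots> = signof p * fun_det n f"
    by (rule Determinant.det_permute_rows[OF _ assms]) simp
  finally show ?thesis .
qed

lemma fun_det_permute_cols:
  assumes "p permutes {0..<n}"
  shows "fun_det n (\<lambda>i j. f i (p j)) = signof p * fun_det n f"
  using fun_det_permute_rows[OF assms, of "\<lambda>i j. f j i"]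
  by (simp add: fun_det_transpose[of n "\<lambda>i j. f i (p j)", symmetric] fun_det_transpose[of n f])

lemma fun_det_eq_0_if_cols_eq:
  assumes "i < n" "j < n" "i \<noteq> j" "\<And>k. k < n \<Longrightarrow> f k i = f k j"
  shows "fun_det n f = 0"
  using assms by (intro Determinant.det_identical_columns[OF _ assms(3)]) (auto intro!: eq_vecI)

text \<open>Multiplicativity with the matrix product written out. It serves below to change columns
  by triangular matrices of determinant 1.\<close>

lemma fun_det_mult: "fun_det n (\<lambda>i j. \<Sum>k<n. f i k * g k j) = fun_det n f * fun_det n g"
proof -
  have "fun_det n f * fun_det n g = Determinant.det (Matrix.mat n n (\<lambda>(i, j). f i j) * Matrix.mat n n (\<lambda>(i, j). g i j))"
    by (intro det_mult[symmetric, where n = n]) auto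
  also have "Matrix.mat n n (\<lambda>(i, j). f i j) * Matrix.mat n n (\<lambda>(i, j). g i j)
      = Matrix.mat n n (\<lambda>(i, j). \<Sum>k<n. f i k * g k j)"
    by (intro eq_matI) (auto simp: scalar_prod_def lessThan_atLeast0)
  finally show ?thesis ..
qed

lemma fun_det_upper:
  assumes "\<And>i j. j < i \<Longrightarrow> i < n \<Longrightarrow> f i j = 0"
  shows "fun_det n f = (\<Prod>i<n. f i i)"
proof -
  have "fun_det n f = prod_list (diag_mat (Matrix.mat n n (\<lambda>(i, j). f i j)))"
    by (rule det_upper_triangular) (auto simp: upper_triangular_def assms)
  also have "\<dots> = (\<Prod>i<n. f i i)"
    by (simp add: prod_list_diag_prod lessThan_atLeast0)
  finally show ?thesis .
qed

lemma fun_det_lower: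
  assumes "\<And>i j. i < j \<Longrightarrow> j < n \<Longrightarrow> f i j = 0"
  shows "fun_det n f = (\<Prod>i<n. f i i)"
  using fun_det_upper[of n "\<lambda>i j. f j i"] assms fun_det_transpose[of n f] by metis

lemma tendsto_fun_det:
  assumes "\<And>i j. i < n \<Longrightarrow> j < n \<Longrightarrow> ((\<lambda>x. f x i j) \<longlongrightarrow> g i j) F"
  shows "((\<lambda>x. fun_det n (f x)) \<longlongrightarrow> fun_det n g) F"
  unfolding fun_det_rows
  by (rule tendsto_sum, rule tendsto_mult[OF tendsto_const], rule tendsto_prod)
    (auto simp: permutes_less assms)

text \<open>Expansion along the first row, of which only the corner entry 1 survives.\<close>

lemma fun_det_first_row:
  assumes "f 0 0 = 1" "\<And>j. 0 < j \<Longrightarrow> j \<le> n \<Longrightarrow> f 0 j = 0"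
  shows "fun_det (Suc n) f = fun_det n (\<lambda>i j. f (Suc i) (Suc j))"
proof -
  let ?A = "Matrix.mat (Suc n) (Suc n) (\<lambda>(i, j). f i j)"
  have "fun_det (Suc n) f = (\<Sum>j<Suc n. ?A $$ (0, j) * cofactor ?A 0 j)"
    by (rule laplace_expansion_row) auto
  also have "\<dots> = cofactor ?A 0 0"
    by (subst lessThan_Suc_atMost, subst atMost_atLeast0, subst sum.atLeast_Suc_atMost) (auto simp: assms)
  also have "mat_delete ?A 0 0 = Matrix.mat n n (\<lambda>(i, j). f (Suc i) (Suc j))"
    by (intro eq_matI) (auto simp: mat_delete_def)
  then have "cofactor ?A 0 0 = fun_det n (\<lambda>i j. f (Suc i) (Suc j))"
    by (simp add: cofactor_def)
  finally show ?thesis .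
qed

text \<open>Laplace expansion along column \<open>m\<close>: the cofactors \<open>C i\<close> do not
  see the entries of that column, so they serve for all \<open>v\<close> at once.\<close>

lemma fun_det_column_linear:
  assumes "m < n"
  shows "\<exists>C. \<forall>v. fun_det n (\<lambda>i j. if j = m then v i else f i j) = (\<Sum>i<n. v i * C i)"
proof -
  let ?A = "\<lambda>v. Matrix.mat n n (\<lambda>(i, j). if j = m then v i else f i j)"
  \<comment> \<open>Taking the cofactors at the zero column makes their independence of
    \<open>v\<close> explicit.\<close>
  have "Determinant.det (?A v) = (\<Sum>i<n. v i * cofactor (?A (\<lambda>_. 0)) i m)" for v
  proof -
    have "mat_delete (?A v) i m = mat_delete (?A (\<lambda>_. 0)) i m" for i
      by (intro eq_matI) (auto simp: mat_delete_def)
    then have "cofactor (?A v) i m = cofactor (?A (\<lambda>_. 0)) i m" for i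
      by (simp add: cofactor_def)
    moreover have "Determinant.det (?A v) = (\<Sum>i<n. ?A v $$ (i, m) * cofactor (?A v) i m)"
      by (rule laplace_expansion_column[OF _ assms]) simp
    ultimately show ?thesis using assms by simp
  qed
  then show ?thesis
    by (intro exI[of _ "\<lambda>i. cofactor (?A (\<lambda>_. 0)) i m"]) simp
qed

text \<open>Passing from monomials to the monic Newton polynomials \<open>q j\<close>, whose roots
  are the \<open>a k\<close> with \<open>k < j\<close>, is a unitriangular change of columns that
  makes the matrix lower triangular.\<close>

lemma vandermonde_eq_fun_det: "vandermonde n a = fun_det n (\<lambda>i j. a i ^ j)"
proof -
  define q where "q j = (\<Prod>k<j. [:- a k, 1:])" for j
  have deg: "degree (q j) = j" for j
    unfolding q_def by (subst degree_prod_eq_sum_degree) auto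
  have lead: "coeff (q j) j = 1" for j
    using lead_coeff_prod[of "\<lambda>k. [:- a k, 1:]" "{..<j}"] deg[of j] by (simp add: q_def)
  have "fun_det n (\<lambda>i j. \<Sum>k<n. a i ^ k * coeff (q j) k)
      = fun_det n (\<lambda>i j. a i ^ j) * fun_det n (\<lambda>k j. coeff (q j) k)"
    by (rule fun_det_mult)
  also have "fun_det n (\<lambda>k j. coeff (q j) k) = 1"
    by (subst fun_det_upper) (auto simp: deg lead coeff_eq_0)
  also have "fun_det n (\<lambda>i j. \<Sum>k<n. a i ^ k * coeff (q j) k) = fun_det n (\<lambda>i j. poly (q j) (a i))"
  proof (rule fun_det_cong)
    fix i j assume "i < n" "j < n"
    show "(\<Sum>k<n. a i ^ k * coeff (q j) k) = poly (q j) (a i)"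
      unfolding poly_altdef deg
      by (rule sum.mono_neutral_cong_right) (use \<open>j < n\<close> in \<open>auto simp: deg coeff_eq_0\<close>)
  qed
  \<comment> \<open>Entries with \<open>i < j\<close> vanish because \<open>a i\<close> is a root of
    \<open>q j\<close>.\<close>
  also have "\<dots> = (\<Prod>i<n. poly (q i) (a i))"
    by (rule fun_det_lower) (auto simp: q_def poly_prod prod_zero_iff)
  also have "\<dots> = vandermonde n a"
    by (simp add: q_def poly_prod vandermonde_def)
  finally show ?thesis by simp
qed

section \<open>Zeros, signs and permutations of the Vandermonde product\<close>

lemma vandermonde_pos:
  assumes "\<And>i j. i < j \<Longrightarrow> j < n \<Longrightarrow> a i < a j"
  shows "vandermonde n a > 0"
  unfolding vandermonde_def using assms by (intro prod_pos ballI) auto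

lemma vandermonde_eq_0_iff:
  "vandermonde n a = 0 \<longleftrightarrow> \<not> inj_on a {..<n}"
proof
  assume "vandermonde n a = 0"
  then show "\<not> inj_on a {..<n}"
    by (force simp: vandermonde_def prod_zero_iff inj_on_def)
next
  assume "\<not> inj_on a {..<n}"
  then obtain i j where "i < n" "j < n" "i \<noteq> j" "a i = a j"
    by (auto simp: inj_on_def)
  then obtain i j where "i < j" "j < n" "a i = a j"
    by (metis linorder_neqE_nat)
  then have "\<exists>c\<in>{..<n}. (\<Prod>b<c. a c - a b) = 0"
    by (intro bexI[of _ j]) (auto simp: prod_zero_iff intro!: bexI[of _ i])
  then show "vandermonde n a = 0"
    unfolding vandermonde_def by (subst prod_zero_iff) auto
qed

lemma vandermonde_permute:
  assumes "p permutes {0..<n}"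
  shows "vandermonde n (a \<circ> p) = signof p * vandermonde n a"
  unfolding vandermonde_eq_fun_det using fun_det_permute_rows[OF assms, of "\<lambda>i j. a i ^ j"] by simp

text \<open>The sorted list of values is read back through the inverse of \<open>a\<close>. This
  reduces sign statements about distinct points to increasing ones.\<close>

lemma obtain_sorting_permutation:
  fixes a :: "nat \<Rightarrow> real"
  assumes "inj_on a {..<n}"
  obtains p where "p permutes {0..<n}" "\<And>i j. i < j \<Longrightarrow> j < n \<Longrightarrow> a (p i) < a (p j)"
proof -
  define xs where "xs = sorted_list_of_set (a ` {..<n})"
  have xs: "distinct xs" "sorted_wrt (<) xs" "set xs = a ` {..<n}"
    by (auto simp: xs_def)
  have len: "length xs = n"
    using distinct_card[OF xs(1)] card_image[OF assms] by (simp add: xs(3))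
  \<comment> \<open>From \<open>n\<close> on the identity is chosen, as \<open>permutes\<close>
    requires.\<close>
  define p where "p i = (if i < n then inv_into {..<n} a (xs ! i) else i)" for i
  have ap: "a (p i) = xs ! i" "p i < n" if "i < n" for i
  proof -
    have "xs ! i \<in> a ` {..<n}"
      using that len xs(3) nth_mem by blast
    from f_inv_into_f[OF this] inv_into_into[OF this] that
    show "a (p i) = xs ! i" "p i < n" by (auto simp: p_def)
  qed
  have lt: "a (p i) < a (p j)" if "i < j" "j < n" for i j
    using ap that len sorted_wrt_nth_less[OF xs(2)] by simp
  have inj: "inj_on p {0..<n}"
  proof (rule inj_onI)
    fix i j assume *: "i \<in> {0..<n}" "j \<in> {0..<n}" "p i = p j"
    show "i = j"
    proof (rule ccontr)
      assume "i \<noteq> j"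
      then consider "i < j" | "j < i" by linarith
      then show False
        using lt[of i j] lt[of j i] * by cases auto
    qed
  qed
  have "p ` {0..<n} = {0..<n}"
    using inj by (intro endo_inj_surj) (auto simp: ap)
  with inj have "bij_betw p {0..<n} {0..<n}"
    by (simp add: bij_betw_def)
  then have "p permutes {0..<n}"
    by (rule bij_imp_permutes) (auto simp: p_def)
  with lt show ?thesis using that by blast
qed

section \<open>Andreief's identity\<close>

lemma signof_mult_self: "signof p * signof p = (1::real)"
  by (simp add: sign_def)

text \<open>Both determinants are expanded over permutations. Each pair of permutations contributes
  a product of functions of one variable each, so its integral factorizes.\<close>

lemma andreief:
  fixes f g :: "nat \<Rightarrow> real \<Rightarrow> real"
  assumes int: "\<And>i j. i < n \<Longrightarrow> j < n \<Longrightarrow> integrable lborel (\<lambda>x. f i x * g j x)"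
  shows "has_bochner_integral (\<Pi>\<^sub>M i\<in>{..<n}. lborel)
    (\<lambda>x. fun_det n (\<lambda>i k. f i (x k)) * fun_det n (\<lambda>j k. g j (x k)))
    (fact n * fun_det n (\<lambda>i j. \<integral>x. f i x * g j x \<partial>lborel))"
proof -
  interpret product_sigma_finite "\<lambda>_::nat. lborel :: real measure" ..
  let ?P = "{p. p permutes {0..<n}}"
  let ?I = "\<lambda>i j. \<integral>x. f i x * g j x \<partial>lborel"
  have perm_term: "has_bochner_integral (\<Pi>\<^sub>M i\<in>{..<n}. lborel)
      (\<lambda>x. signof p * signof q * (\<Prod>k<n. f (p k) (x k) * g (q k) (x k)))
      (signof p * signof q * (\<Prod>k<n. ?I (p k) (q k)))" if "p \<in> ?P" "q \<in> ?P" for p q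
  proof -
    have lt: "k < n \<Longrightarrow> p k < n" "k < n \<Longrightarrow> q k < n" for k
      using that permutes_in_image[of p "{0..<n}"] permutes_in_image[of q "{0..<n}"] by auto
    show ?thesis
      using lt
      by (intro has_bochner_integral_mult_right)
        (auto simp: has_bochner_integral_iff intro!: product_integrable_prod product_integral_prod int)
  qed
  have "has_bochner_integral (\<Pi>\<^sub>M i\<in>{..<n}. lborel)
      (\<lambda>x. \<Sum>p\<in>?P. \<Sum>q\<in>?P. signof p * signof q * (\<Prod>k<n. f (p k) (x k) * g (q k) (x k)))
      (\<Sum>p\<in>?P. \<Sum>q\<in>?P. signof p * signof q * (\<Prod>k<n. ?I (p k) (q k)))"
    by (intro has_bochner_integral_sum perm_term)
  also have "(\<lambda>x. \<Sum>p\<in>?P. \<Sum>q\<in>?P. signof p * signof q * (\<Prod>k<n. f (p k) (x k) * g (q k) (x k)))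
      = (\<lambda>x. fun_det n (\<lambda>i k. f i (x k)) * fun_det n (\<lambda>j k. g j (x k)))"
    unfolding fun_det_cols sum_product by (simp add: prod.distrib mult_ac)
  \<comment> \<open>For fixed \<open>p\<close> the sum over \<open>q\<close> is, up to the sign of
    \<open>p\<close>, the determinant with rows permuted by \<open>p\<close>. The signs cancel, so
    each of the n! permutations \<open>p\<close> contributes the same value.\<close>
  also have "(\<Sum>p\<in>?P. \<Sum>q\<in>?P. signof p * signof q * (\<Prod>k<n. ?I (p k) (q k))) = (\<Sum>p\<in>?P. fun_det n ?I)"
  proof (rule sum.cong[OF refl])
    fix p assume "p \<in> ?P"
    have "(\<Sum>q\<in>?P. signof p * signof q * (\<Prod>k<n. ?I (p k) (q k))) = signof p * fun_det n (\<lambda>i j. ?I (p i) j)"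
      unfolding fun_det_rows by (simp add: sum_distrib_left mult_ac)
    also have "\<dots> = signof p * (signof p * fun_det n ?I)"
      using fun_det_permute_rows[of p n ?I] \<open>p \<in> ?P\<close> by simp
    also have "\<dots> = fun_det n ?I"
      by (simp add: signof_mult_self flip: mult.assoc)
    finally show "(\<Sum>q\<in>?P. signof p * signof q * (\<Prod>k<n. ?I (p k) (q k))) = fun_det n ?I" .
  qed
  also have "\<dots> = fact n * fun_det n ?I"
    using card_permutations[of "{0..<n}" n] by simp
  finally show ?thesis .
qed

section \<open>Sign of exponential and Polya frequency determinants\<close>

text \<open>The mean value theorem, applied to one column after the other.\<close>

lemma fun_det_difference_nonneg:
  fixes u u' :: "nat \<Rightarrow> real \<Rightarrow> real"
  assumes deriv: "\<And>i x. (u i has_real_derivative u' i x) (at x)"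
    and t: "\<And>j. j < n \<Longrightarrow> t j < t (Suc j)"
    and pos: "\<And>\<tau>. (\<And>j. j < n \<Longrightarrow> t j \<le> \<tau> j \<and> \<tau> j \<le> t (Suc j)) \<Longrightarrow> 0 \<le> fun_det n (\<lambda>i j. u' i (\<tau> j))"
  shows "0 \<le> fun_det n (\<lambda>i j. u i (t (Suc j)) - u i (t j))"
proof -
  \<comment> \<open>Induction on the number \<open>m\<close> of columns already turned into
    increments. The points \<open>\<tau> j\<close> of the other columns stay free because the next
    step varies one of them.\<close>
  have "0 \<le> fun_det n (\<lambda>i j. if j < m then u i (t (Suc j)) - u i (t j) else u' i (\<tau> j))"
    if "m \<le> n" "\<And>j. j < n \<Longrightarrow> t j \<le> \<tau> j \<and> \<tau> j \<le> t (Suc j)" for m \<tau>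
    using that
  proof (induction m arbitrary: \<tau>)
    case 0
    then show ?case using pos[of \<tau>] by simp
  next
    case (Suc m)
    let ?A = "\<lambda>i j. if j < m then u i (t (Suc j)) - u i (t j) else u' i (\<tau> j)"
    obtain C where C: "\<And>v. fun_det n (\<lambda>i j. if j = m then v i else ?A i j) = (\<Sum>i<n. v i * C i)"
      using fun_det_column_linear[of m n ?A] Suc.prems by auto
    \<comment> \<open>\<open>h x\<close> is the determinant with \<open>u i x\<close> in column
      \<open>m\<close>. Its derivative has \<open>u' i x\<close> there and is nonnegative by the
      induction hypothesis, so \<open>h\<close> increases between the two points.\<close>
    define h where "h x = (\<Sum>i<n. u i x * C i)" for x
    have h_deriv: "(h has_real_derivative (\<Sum>i<n. u' i x * C i)) (at x)" for x
      unfolding h_def by (intro DERIV_sum DERIV_cmult_right deriv)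
    have "0 \<le> (\<Sum>i<n. u' i x * C i)" if x: "t m \<le> x" "x \<le> t (Suc m)" for x
    proof -
      have "0 \<le> fun_det n (\<lambda>i j. if j < m then u i (t (Suc j)) - u i (t j) else u' i ((\<tau>(m := x)) j))"
        by (rule Suc.IH) (use Suc.prems x in auto)
      also have "\<dots> = fun_det n (\<lambda>i j. if j = m then u' i x else ?A i j)"
        by (rule fun_det_cong) auto
      finally show ?thesis by (simp add: C)
    qed
    then have "\<exists>y. (h has_real_derivative y) (at x) \<and> 0 \<le> y" if "t m \<le> x" "x \<le> t (Suc m)" for x
      using h_deriv that by blast
    then have "h (t m) \<le> h (t (Suc m))"
      using t[of m] Suc.prems DERIV_nonneg_imp_nondecreasing[of "t m" "t (Suc m)" h] by simp
    then have "0 \<le> (\<Sum>i<n. (u i (t (Suc m)) - u i (t m)) * C i)"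
      by (simp add: h_def left_diff_distrib sum_subtractf)
    also have "\<dots> = fun_det n (\<lambda>i j. if j = m then u i (t (Suc m)) - u i (t m) else ?A i j)"
      by (simp only: C)
    also have "\<dots> = fun_det n (\<lambda>i j. if j < Suc m then u i (t (Suc j)) - u i (t j) else u' i (\<tau> j))"
      by (rule fun_det_cong) auto
    finally show ?case .
  qed
  from this[of n t] t have "0 \<le> fun_det n (\<lambda>i j. if j < n then u i (t (Suc j)) - u i (t j) else u' i (t j))"
    by (auto intro: less_imp_le)
  also have "\<dots> = fun_det n (\<lambda>i j. u i (t (Suc j)) - u i (t j))"
    by (rule fun_det_cong) auto
  finally show ?thesis .
qed

text \<open>Total positivity of the exponential kernel, by induction on the size. After
  normalization and column differences the first row is (1, 0, ..., 0), and the mean value argument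
  reduces the remaining minor to exponentials at intermediate points. These may coincide, so
  \<open>t\<close> is only weakly increasing.\<close>

lemma fun_det_exp_nonneg_sorted:
  assumes "\<And>i j. i < j \<Longrightarrow> j < n \<Longrightarrow> s i < s j" "\<And>i j. i < j \<Longrightarrow> j < n \<Longrightarrow> t i \<le> t j"
  shows "0 \<le> fun_det n (\<lambda>i j. exp (s i * t j))"
  using assms
proof (induction n arbitrary: s t)
  case 0
  then show ?case by (simp add: fun_det_rows)
next
  case (Suc n)
  \<comment> \<open>Factoring \<open>exp (s 0 * t j)\<close> out of column \<open>j\<close> leaves
    the exponents \<open>\<sigma> i\<close>; since \<open>\<sigma> 0 = 0\<close>, the first row
    becomes constant 1.\<close>
  define \<sigma> where "\<sigma> i = s i - s 0" for i
  show ?case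
  proof (cases "\<exists>i j. i < j \<and> j < Suc n \<and> t i = t j")
    case True
    then obtain i j where "i < j" "j < Suc n" "t i = t j" by blast
    then have "fun_det (Suc n) (\<lambda>i j. exp (s i * t j)) = 0"
      by (intro fun_det_eq_0_if_cols_eq[of i _ j]) auto
    then show ?thesis by simp
  next
    case False
    have t: "t i < t j" if "i < j" "j < Suc n" for i j
      using False Suc.prems(2)[OF that] that by (meson order_le_less)
    \<comment> \<open>The columns of \<open>E\<close> are successive differences, so column
      \<open>j\<close> of the matrix is the sum of the columns of \<open>E\<close> up to
      \<open>j\<close>: a unitriangular change.\<close>
    define E where "E i j = (if j = 0 then exp (\<sigma> i * t 0) else exp (\<sigma> i * t j) - exp (\<sigma> i * t (j - 1)))" for i j
    have E_sum: "(\<Sum>k\<le>j. E i k) = exp (\<sigma> i * t j)" for i j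
      by (induction j) (auto simp: E_def)
    have "fun_det (Suc n) (\<lambda>i j. exp (s i * t j)) = fun_det (Suc n) (\<lambda>i j. exp (s 0 * t j) * exp (\<sigma> i * t j))"
      by (simp add: \<sigma>_def flip: exp_add) (simp add: algebra_simps)
    also have "\<dots> = (\<Prod>j<Suc n. exp (s 0 * t j)) * fun_det (Suc n) (\<lambda>i j. exp (\<sigma> i * t j))"
      by (rule fun_det_scale_cols)
    also have "fun_det (Suc n) (\<lambda>i j. exp (\<sigma> i * t j))
        = fun_det (Suc n) (\<lambda>i j. \<Sum>k<Suc n. E i k * (if k \<le> j then 1 else 0))"
    proof (rule fun_det_cong)
      fix i j assume "i < Suc n" "j < Suc n"
      then have "(\<Sum>k<Suc n. E i k * (if k \<le> j then 1 else 0)) = (\<Sum>k\<le>j. E i k)"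
        by (intro sum.mono_neutral_cong_right) auto
      then show "exp (\<sigma> i * t j) = (\<Sum>k<Suc n. E i k * (if k \<le> j then 1 else 0))"
        by (simp only: E_sum)
    qed
    also have "\<dots> = fun_det (Suc n) E * fun_det (Suc n) (\<lambda>k j. if k \<le> j then 1 else 0)"
      by (rule fun_det_mult)
    also have "fun_det (Suc n) (\<lambda>k j. if k \<le> j then 1 else 0) = 1"
      by (subst fun_det_upper) auto
    also have "fun_det (Suc n) E = fun_det n (\<lambda>i j. E (Suc i) (Suc j))"
      by (rule fun_det_first_row) (auto simp: E_def \<sigma>_def)
    also have "\<dots> = fun_det n (\<lambda>i j. exp (\<sigma> (Suc i) * t (Suc j)) - exp (\<sigma> (Suc i) * t j))"
      by (simp add: E_def)
    finally have eq: "fun_det (Suc n) (\<lambda>i j. exp (s i * t j))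
      = (\<Prod>j<Suc n. exp (s 0 * t j)) * fun_det n (\<lambda>i j. exp (\<sigma> (Suc i) * t (Suc j)) - exp (\<sigma> (Suc i) * t j))"
      by simp
    have "0 \<le> fun_det n (\<lambda>i j. exp (\<sigma> (Suc i) * t (Suc j)) - exp (\<sigma> (Suc i) * t j))"
    proof (rule fun_det_difference_nonneg[of "\<lambda>i x. exp (\<sigma> (Suc i) * x)" "\<lambda>i x. \<sigma> (Suc i) * exp (\<sigma> (Suc i) * x)"])
      show "((\<lambda>x. exp (\<sigma> (Suc i) * x)) has_real_derivative \<sigma> (Suc i) * exp (\<sigma> (Suc i) * x)) (at x)" for i x
        by (auto intro!: derivative_eq_intros)
      show "t j < t (Suc j)" if "j < n" for j
        using t[of j "Suc j"] that by simp
      fix \<tau> assume \<tau>: "\<And>j. j < n \<Longrightarrow> t j \<le> \<tau> j \<and> \<tau> j \<le> t (Suc j)"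
      \<comment> \<open>The intermediate points lie in adjacent intervals, hence are weakly
        ordered.\<close>
      have "\<tau> i \<le> \<tau> j" if "i < j" "j < n" for i j
      proof -
        have "\<tau> i \<le> t (Suc i)" using \<tau>[of i] that by simp
        also have "\<dots> \<le> t j"
        proof (cases "Suc i = j")
          case False
          with t[of "Suc i" j] that show ?thesis by simp
        qed simp
        also have "\<dots> \<le> \<tau> j" using \<tau>[of j] that by simp
        finally show ?thesis .
      qed
      then have "0 \<le> fun_det n (\<lambda>i j. exp (\<sigma> (Suc i) * \<tau> j))"
        by (intro Suc.IH) (auto simp: \<sigma>_def Suc.prems)
      moreover have "0 \<le> (\<Prod>i<n. \<sigma> (Suc i))"
        using Suc.prems(1)[of 0] by (intro prod_nonneg) (auto simp: \<sigma>_def intro: less_imp_le)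
      ultimately show "0 \<le> fun_det n (\<lambda>i j. \<sigma> (Suc i) * exp (\<sigma> (Suc i) * \<tau> j))"
        by (simp add: fun_det_scale_rows)
    qed
    then show ?thesis
      unfolding eq by (intro mult_nonneg_nonneg prod_nonneg) auto
  qed
qed

text \<open>For positive points, -1/y increases with y, so after sorting both families the kernel is
  an exponential one with increasing parameters. The signs of the sorting permutations cancel
  against those of the Vandermonde factors, which vanish if points coincide.\<close>

lemma fun_det_exp_inverse_nonneg:
  assumes pos: "\<And>k. k < n \<Longrightarrow> y k > 0"
  shows "0 \<le> vandermonde n a * vandermonde n y * fun_det n (\<lambda>i j. exp (- (a i / y j)))"
proof (cases "inj_on a {..<n} \<and> inj_on y {..<n}")
  case False
  then have "vandermonde n a = 0 \<or> vandermonde n y = 0"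
    by (auto simp: vandermonde_eq_0_iff)
  then show ?thesis by auto
next
  case True
  obtain p where p: "p permutes {0..<n}" "\<And>i j. i < j \<Longrightarrow> j < n \<Longrightarrow> a (p i) < a (p j)"
    using obtain_sorting_permutation True by blast
  obtain q where q: "q permutes {0..<n}" "\<And>i j. i < j \<Longrightarrow> j < n \<Longrightarrow> y (q i) < y (q j)"
    using obtain_sorting_permutation True by blast
  have "- inverse (y (q i)) \<le> - inverse (y (q j))" if "i < j" "j < n" for i j
    using q(2)[OF that] pos[of "q i"] that permutes_less[OF q(1)] by (auto intro: le_imp_inverse_le)
  then have "0 \<le> fun_det n (\<lambda>i j. exp (a (p i) * - inverse (y (q j))))"
    by (intro fun_det_exp_nonneg_sorted p)
  also have "\<dots> = signof p * (signof q * fun_det n (\<lambda>i j. exp (- (a i / y j))))"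
    by (simp add: divide_inverse fun_det_permute_rows[OF p(1), of "\<lambda>i j. exp (- (a i / y (q j)))", simplified divide_inverse]
      fun_det_permute_cols[OF q(1), of "\<lambda>i j. exp (- (a i / y j))", simplified divide_inverse])
  finally have "0 \<le> signof p * (signof q * fun_det n (\<lambda>i j. exp (- (a i / y j))))" .
  moreover have "0 \<le> vandermonde n (a \<circ> p) * vandermonde n (y \<circ> q)"
    using p(2) q(2) by (intro mult_nonneg_nonneg less_imp_le[OF vandermonde_pos]) auto
  ultimately have "0 \<le> vandermonde n (a \<circ> p) * vandermonde n (y \<circ> q) * (signof p * (signof q * fun_det n (\<lambda>i j. exp (- (a i / y j)))))"
    by (simp only: mult_nonneg_nonneg)
  also have "\<dots> = (signof p * signof p) * (signof q * signof q) *
      (vandermonde n a * vandermonde n y * fun_det n (\<lambda>i j. exp (- (a i / y j))))"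
    by (simp add: vandermonde_permute[OF p(1)] vandermonde_permute[OF q(1)] mult_ac)
  finally show ?thesis by (simp only: signof_mult_self mult_1_left)
qed

section \<open>Iterated backward differences and derivatives\<close>

fun back_diff :: "real \<Rightarrow> nat \<Rightarrow> (real \<Rightarrow> real) \<Rightarrow> real \<Rightarrow> real" where
  "back_diff h 0 f x = f x"
| "back_diff h (Suc c) f x = back_diff h c f x - back_diff h c f (x - h)"

text \<open>The innermost difference may be traded for the outermost one, so that a function can be
  replaced by its first difference.\<close>

lemma back_diff_shift: "back_diff h c (\<lambda>x. f x - f (x - h)) x = back_diff h c f x - back_diff h c f (x - h)"
  by (induction c arbitrary: x) auto

text \<open>These are the numbers (-1)^k (c choose k), given by a recursion that mirrors the one of
  \<open>back_diff\<close>.\<close>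

fun back_diff_coeff :: "nat \<Rightarrow> nat \<Rightarrow> real" where
  "back_diff_coeff 0 k = (if k = 0 then 1 else 0)"
| "back_diff_coeff (Suc c) k = back_diff_coeff c k - (if k = 0 then 0 else back_diff_coeff c (k - 1))"

lemma back_diff_coeff_eq_0: "c < k \<Longrightarrow> back_diff_coeff c k = 0"
  by (induction c k rule: back_diff_coeff.induct) auto

lemma back_diff_coeff_diag: "back_diff_coeff c c = (-1) ^ c"
  by (induction c) (auto simp: back_diff_coeff_eq_0)

lemma back_diff_eq_sum: "back_diff h c f x = (\<Sum>k\<le>c. f (x - real k * h) * back_diff_coeff c k)"
proof (induction c arbitrary: x)
  case 0
  show ?case by simp
next
  case (Suc c)
  have "back_diff h (Suc c) f x = (\<Sum>k\<le>c. f (x - real k * h) * back_diff_coeff c k)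
      - (\<Sum>k\<le>c. f (x - h - real k * h) * back_diff_coeff c k)"
    by (simp add: Suc.IH)
  \<comment> \<open>Both sums are brought to the range up to \<open>Suc c\<close>: the first by
    adding a zero term, the second by an index shift.\<close>
  also have "(\<Sum>k\<le>c. f (x - real k * h) * back_diff_coeff c k)
      = (\<Sum>k\<le>Suc c. f (x - real k * h) * back_diff_coeff c k)"
    by (simp add: back_diff_coeff_eq_0)
  also have "(\<Sum>k\<le>c. f (x - h - real k * h) * back_diff_coeff c k)
      = (\<Sum>k\<le>Suc c. f (x - real k * h) * (if k = 0 then 0 else back_diff_coeff c (k - 1)))"
    by (subst sum.atMost_Suc_shift) (simp add: algebra_simps)
  finally show ?case
    by (simp only: back_diff_coeff.simps right_diff_distrib sum_subtractf)
qed

lemma DERIV_shift_back: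
  fixes f :: "real \<Rightarrow> real"
  assumes "(f has_real_derivative D) (at (x - h))"
  shows "((\<lambda>x. f (x - h)) has_real_derivative D) (at x)"
  using assms DERIV_shift[of f D x "- h"] by simp

text \<open>The induction hypothesis is applied to the first differences of all \<open>g j\<close>.
  It leaves one increment of \<open>g m\<close>, to which the mean value theorem applies.\<close>

lemma back_diff_mvt:
  assumes "\<And>j x. j < m \<Longrightarrow> (g j has_real_derivative g (Suc j) x) (at x)" "h > 0"
  shows "\<exists>\<xi>. x - real m * h \<le> \<xi> \<and> \<xi> \<le> x \<and> back_diff h m (g 0) x = h ^ m * g m \<xi>"
  using assms(1)
proof (induction m arbitrary: g x)
  case 0
  show ?case by auto
next
  case (Suc m)
  define u where "u j x = g j x - g j (x - h)" for j x
  have "(u j has_real_derivative u (Suc j) x) (at x)" if "j < m" for j x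
    unfolding u_def using Suc.prems[of j] that
    by (intro DERIV_diff DERIV_shift_back) simp_all
  from Suc.IH[of u, OF this] obtain \<xi> where
    \<xi>: "x - real m * h \<le> \<xi>" "\<xi> \<le> x" "back_diff h m (u 0) x = h ^ m * u m \<xi>"
    by blast
  obtain z where z: "\<xi> - h < z" "z < \<xi>" "g m \<xi> - g m (\<xi> - h) = (\<xi> - (\<xi> - h)) * g (Suc m) z"
    using MVT2[of "\<xi> - h" \<xi> "g m" "g (Suc m)"] Suc.prems[of m] \<open>h > 0\<close> by auto
  have "back_diff h (Suc m) (g 0) x = back_diff h m (u 0) x"
    unfolding u_def by (simp add: back_diff_shift)
  also have "\<dots> = h ^ Suc m * g (Suc m) z"
    using \<xi>(3) z(3) by (simp add: u_def)
  finally show ?case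
    using \<xi> z by (intro exI[of _ z]) (auto simp: algebra_simps)
qed

text \<open>Continuity of \<open>g c\<close> is not assumed, so the mean value theorem is used only
  up to order c - 1. The last order comes from differentiability of \<open>g (c - 1)\<close> at
  \<open>x\<close> itself.\<close>

lemma back_diff_tendsto:
  assumes deriv: "\<And>j x. j < c \<Longrightarrow> (g j has_real_derivative g (Suc j) x) (at x)"
  shows "((\<lambda>h. back_diff h c (g 0) x / h ^ c) \<longlongrightarrow> g c x) (at_right 0)"
proof (cases c)
  case 0
  then show ?thesis by simp
next
  case (Suc m)
  define r where "r = g m" 
  define d where "d = g c x"
  have r: "(r has_real_derivative d) (at x)"
    using deriv[of m x] by (simp add: r_def d_def Suc)
  \<comment> \<open>All but one of the differences are replaced by derivatives at one point
    \<open>\<xi>\<close>; both \<open>\<xi>\<close> and \<open>\<xi> - h\<close> stay within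
    \<open>c * h\<close> of \<open>x\<close>.\<close>
  have repr: "\<exists>\<xi>. x - real m * h \<le> \<xi> \<and> \<xi> \<le> x \<and> back_diff h c (g 0) x / h ^ c = (r \<xi> - r (\<xi> - h)) / h"
    if "h > 0" for h
  proof -
    have "((\<lambda>x. g j x - g j (x - h)) has_real_derivative g (Suc j) x - g (Suc j) (x - h)) (at x)"
      if "j < m" for j x
      using deriv[of j] that Suc
      by (intro DERIV_diff DERIV_shift_back) simp_all
    from back_diff_mvt[of m "\<lambda>j x. g j x - g j (x - h)", OF this \<open>h > 0\<close>, of x]
    obtain \<xi> where \<xi>: "x - real m * h \<le> \<xi>" "\<xi> \<le> x"
      "back_diff h m (\<lambda>x. g 0 x - g 0 (x - h)) x = h ^ m * (g m \<xi> - g m (\<xi> - h))"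
      by blast
    then show ?thesis
      using \<open>h > 0\<close> by (intro exI[of _ \<xi>]) (auto simp: back_diff_shift Suc r_def)
  qed
  show ?thesis
  proof (rule tendstoI)
    fix e :: real assume "e > 0"
    \<comment> \<open>The linearization at \<open>x\<close> is used at two points, each with an
      error of at most \<open>e' * c * h\<close>; this choice keeps the sum below
      \<open>e * h\<close>.\<close>
    define e' where "e' = e / (2 * real c + 1)"
    have "e' > 0" using \<open>e > 0\<close> by (simp add: e'_def)
    obtain \<delta> where "\<delta> > 0" and \<delta>: "\<And>z. \<bar>z - x\<bar> < \<delta> \<Longrightarrow> \<bar>r z - r x - (z - x) * d\<bar> \<le> e' * \<bar>z - x\<bar>"
      using r \<open>e' > 0\<close> unfolding has_field_derivative_def has_derivative_within_alt
      by (auto simp: mult.commute)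
    have "eventually (\<lambda>h::real. 0 < h \<and> h < \<delta> / (real c + 1)) (at_right 0)"
      using \<open>\<delta> > 0\<close> eventually_at_right[of 0 "1::real"] by (auto simp: eventually_at_right intro!: exI[of _ "\<delta> / (real c + 1)"])
    then show "eventually (\<lambda>h. dist (back_diff h c (g 0) x / h ^ c) (g c x) < e) (at_right 0)"
    proof eventually_elim
      case (elim h)
      then have h: "h > 0" "real c * h < \<delta>"
        by (auto simp: field_simps)
      obtain \<xi> where \<xi>: "x - real m * h \<le> \<xi>" "\<xi> \<le> x"
        "back_diff h c (g 0) x / h ^ c = (r \<xi> - r (\<xi> - h)) / h"
        using repr[OF h(1)] by blast
      have near: "\<bar>\<xi> - x\<bar> \<le> real c * h" "\<bar>\<xi> - h - x\<bar> \<le> real c * h"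
        using \<xi> h by (auto simp: Suc algebra_simps)
      have "\<bar>r \<xi> - r x - (\<xi> - x) * d\<bar> \<le> e' * (real c * h)"
        using \<delta>[of \<xi>] near h \<open>e' > 0\<close> by (meson dual_order.trans le_less_trans less_imp_le mult_left_mono)
      moreover have "\<bar>r (\<xi> - h) - r x - (\<xi> - h - x) * d\<bar> \<le> e' * (real c * h)"
        using \<delta>[of "\<xi> - h"] near h \<open>e' > 0\<close> by (meson dual_order.trans le_less_trans less_imp_le mult_left_mono)
      ultimately have "\<bar>r \<xi> - r (\<xi> - h) - h * d\<bar> \<le> 2 * (e' * (real c * h))"
        by (simp add: algebra_simps)
      also have "\<dots> < e * h"
        using h \<open>e > 0\<close> by (simp add: e'_def field_simps)
      finally have "\<bar>r \<xi> - r (\<xi> - h) - h * d\<bar> / h < e"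
        using h by (simp add: field_simps)
      then have "\<bar>(r \<xi> - r (\<xi> - h) - h * d) / h\<bar> < e"
        using h by (simp add: abs_divide)
      also have "(r \<xi> - r (\<xi> - h) - h * d) / h = (r \<xi> - r (\<xi> - h)) / h - d"
        using h by (simp add: field_simps)
      finally show ?case
        by (simp add: dist_real_def \<xi>(3) d_def)
    qed
  qed
qed

text \<open>The defining inequality of order \<open>n\<close> is taken at the nodes
  \<open>k * h\<close>, whose Vandermonde product is positive. Column operations turn the translates
  into signed backward differences; dividing by powers of \<open>h\<close> and letting
  \<open>h\<close> tend to 0 gives the derivatives.\<close>

lemma polya_frequency_derivatives:
  assumes pf: "polya_frequency_function n w" and "n \<ge> 1"
    and deriv: "\<And>j x. Suc j < n \<Longrightarrow> (g j has_real_derivative g (Suc j) x) (at x)"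
    and g0: "g 0 = w"
  shows "0 \<le> vandermonde n x * fun_det n (\<lambda>j k. (-1) ^ j * g j (x k))"
proof -
  have "0 \<le> vandermonde n x * fun_det n (\<lambda>i j. (-1) ^ j * (back_diff h j w (x i) / h ^ j))" if "h > 0" for h
  proof -
    have "0 \<le> vandermonde n x * vandermonde n (\<lambda>k. real k * h) * fun_det n (\<lambda>i k. w (x i - real k * h))"
      using pf \<open>n \<ge> 1\<close> unfolding polya_frequency_function_def by auto
    moreover have "vandermonde n (\<lambda>k. real k * h) > 0"
      using \<open>h > 0\<close> by (intro vandermonde_pos) auto
    ultimately have "0 \<le> vandermonde n x * fun_det n (\<lambda>i k. w (x i - real k * h))"
      by (simp add: zero_le_mult_iff mult_le_0_iff)
    \<comment> \<open>The sign (-1)^j makes the diagonal of the triangular coefficient matrix equal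
      to 1.\<close>
    also have "fun_det n (\<lambda>i k. w (x i - real k * h))
        = fun_det n (\<lambda>i k. w (x i - real k * h)) * fun_det n (\<lambda>k j. (-1) ^ j * back_diff_coeff j k)"
      by (subst (2) fun_det_upper) (auto simp: back_diff_coeff_eq_0 back_diff_coeff_diag simp flip: power_mult_distrib)
    also have "\<dots> = fun_det n (\<lambda>i j. \<Sum>k<n. w (x i - real k * h) * ((-1) ^ j * back_diff_coeff j k))"
      by (rule fun_det_mult[symmetric])
    also have "\<dots> = fun_det n (\<lambda>i j. (-1) ^ j * back_diff h j w (x i))"
    proof (rule fun_det_cong)
      fix i j assume "i < n" "j < n"
      have "(\<Sum>k<n. w (x i - real k * h) * ((-1) ^ j * back_diff_coeff j k))
          = (\<Sum>k\<le>j. (-1) ^ j * (w (x i - real k * h) * back_diff_coeff j k))"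
        using \<open>j < n\<close> by (intro sum.mono_neutral_cong_right) (auto simp: back_diff_coeff_eq_0)
      then show "(\<Sum>k<n. w (x i - real k * h) * ((-1) ^ j * back_diff_coeff j k)) = (-1) ^ j * back_diff h j w (x i)"
        by (simp add: back_diff_eq_sum sum_distrib_left)
    qed
    finally have "0 \<le> (\<Prod>j<n. inverse (h ^ j)) * (vandermonde n x * fun_det n (\<lambda>i j. (-1) ^ j * back_diff h j w (x i)))"
      using \<open>h > 0\<close> by (intro mult_nonneg_nonneg[OF prod_nonneg]) auto
    also have "\<dots> = vandermonde n x * fun_det n (\<lambda>i j. inverse (h ^ j) * ((-1) ^ j * back_diff h j w (x i)))"
      by (simp only: fun_det_scale_cols mult_ac)
    finally show ?thesis
      by (simp add: divide_inverse mult_ac)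
  qed
  then have ev: "eventually (\<lambda>h. 0 \<le> vandermonde n x * fun_det n (\<lambda>i j. (-1) ^ j * (back_diff h j w (x i) / h ^ j))) (at_right 0)"
    by (intro eventually_mono[OF eventually_at_right_less[of "0::real"]]) simp
  have lim: "((\<lambda>h. vandermonde n x * fun_det n (\<lambda>i j. (-1) ^ j * (back_diff h j w (x i) / h ^ j)))
      \<longlongrightarrow> vandermonde n x * fun_det n (\<lambda>i j. (-1) ^ j * g j (x i))) (at_right 0)"
    unfolding g0[symmetric]
    by (intro tendsto_mult tendsto_const tendsto_fun_det back_diff_tendsto deriv) auto
  have "0 \<le> vandermonde n x * fun_det n (\<lambda>i j. (-1) ^ j * g j (x i))"
    by (rule tendsto_lowerbound[OF lim ev]) simp
  also have "fun_det n (\<lambda>i j. (-1) ^ j * g j (x i)) = fun_det n (\<lambda>j k. (-1) ^ j * g j (x k))"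
    using fun_det_transpose[of n "\<lambda>j k. (-1) ^ j * g j (x k)"] .
  finally show ?thesis .
qed

section \<open>Mixtures of exponential kernels\<close>

text \<open>The inequality ln t <= t - 1 at \<open>t = x * u / b\<close> gives the bound
  \<open>(b / x) powr b\<close>.\<close>

lemma powr_mult_exp_bounded:
  fixes b x :: real
  assumes "0 \<le> b" "0 < x"
  shows "\<exists>B\<ge>0. \<forall>u>0. u powr b * exp (- (x * u)) \<le> B"
proof (cases "b = 0")
  case True
  then show ?thesis using assms by (intro exI[of _ 1]) auto
next
  case False
  then have b: "b > 0" using assms by simp
  have "u powr b * exp (- (x * u)) \<le> (b / x) powr b" if "u > 0" for u
  proof -
    have "ln (x * u / b) \<le> x * u / b"
      using ln_le_minus_one[of "x * u / b"] that assms b by simp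
    then have "b * ln (x * u / b) \<le> x * u"
      using b by (simp add: field_simps)
    moreover have "ln (x * u / b) = ln u - ln (b / x)"
      using that assms b by (simp add: ln_mult ln_div)
    then have "b * ln (x * u / b) = b * ln u - b * ln (b / x)"
      by (simp add: right_diff_distrib)
    ultimately have "b * ln u + - (x * u) \<le> b * ln (b / x)"
      by linarith
    then have "exp (b * ln u) * exp (- (x * u)) \<le> exp (b * ln (b / x))"
      by (simp flip: exp_add)
    then show ?thesis
      using that assms b by (simp add: powr_def)
  qed
  then show ?thesis by (intro exI[of _ "(b / x) powr b"]) auto
qed

text \<open>Taylor's formula of order two with Lagrange remainder.\<close>

lemma exp_minus_linear_bound: "\<bar>exp z - 1 - z\<bar> \<le> z\<^sup>2 * exp \<bar>z\<bar>" for z :: real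
proof -
  obtain t where t: "\<bar>t\<bar> \<le> \<bar>z\<bar>" "exp z = (\<Sum>m<2. z ^ m / fact m) + exp t / fact 2 * z ^ 2"
    using Maclaurin_exp_le[of z 2] by blast
  then have "\<bar>exp z - 1 - z\<bar> = exp t / 2 * z\<^sup>2"
    by (simp add: eval_nat_numeral)
  also have "\<dots> \<le> exp \<bar>z\<bar> * z\<^sup>2"
  proof (intro mult_right_mono)
    have "exp t / 2 \<le> exp t" by simp
    also have "\<dots> \<le> exp \<bar>z\<bar>" using t by simp
    finally show "exp t / 2 \<le> exp \<bar>z\<bar>" .
  qed simp
  finally show ?thesis by (simp add: mult.commute)
qed

text \<open>
  The integral runs over the whole line but is only used for functions that vanish on \<open>{..0}\<close>,
  which hides the junk values of \<open>powr\<close> and of the division there.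
\<close>

definition exp_transform :: "real \<Rightarrow> (real \<Rightarrow> real) \<Rightarrow> real \<Rightarrow> real" where
  "exp_transform b g x = (\<integral>y. exp (- (x / y)) * y powr (- b) * g y \<partial>lborel)"

definition integrable_pos_supp :: "(real \<Rightarrow> real) \<Rightarrow> bool" where
  "integrable_pos_supp g \<longleftrightarrow> integrable lborel g \<and> (\<forall>y\<le>0. g y = 0)"

section \<open>Integrability and differentiation of the transform\<close>

lemma powr_minus_add_one: "y > 0 \<Longrightarrow> y powr (- (b + 1)) = y powr (- b) / y" for b y :: real
  using powr_add[of y "- b" "- 1"] by (simp add: powr_neg_one)

lemma powr_minus_add_two: "y > 0 \<Longrightarrow> y powr (- (b + 2)) = y powr (- b) / y\<^sup>2" for b y :: real
  using powr_add[of y "- b" "- 2"] by (simp add: powr_neg_numeral)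

lemma exp_kernel_bounded:
  fixes x b :: real
  assumes "0 < x" "0 \<le> b"
  obtains B where "B \<ge> 0" "\<And>y. y > 0 \<Longrightarrow> exp (- (x / y)) * y powr (- b) \<le> B"
proof -
  obtain B where "B \<ge> 0" and B: "\<And>u. u > 0 \<Longrightarrow> u powr b * exp (- (x * u)) \<le> B"
    using powr_mult_exp_bounded[OF assms(2,1)] by blast
  have "exp (- (x / y)) * y powr (- b) \<le> B" if "y > 0" for y
    using B[of "inverse y"] that by (simp add: powr_minus inverse_powr divide_inverse mult.commute)
  with \<open>B \<ge> 0\<close> show ?thesis using that by blast
qed

text \<open>The kernel is bounded on the positive half-line, and \<open>g\<close> is integrable and
  vanishes elsewhere.\<close>

lemma exp_transform_integrable:
  assumes g: "integrable_pos_supp g" and "0 < x" "0 \<le> b"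
  shows "integrable lborel (\<lambda>y. exp (- (x / y)) * y powr (- b) * g y)"
proof -
  obtain B where B: "\<And>y. y > 0 \<Longrightarrow> exp (- (x / y)) * y powr (- b) \<le> B"
    using exp_kernel_bounded assms by metis
  have [measurable]: "g \<in> borel_measurable borel"
    using g by (auto simp: integrable_pos_supp_def)
  show ?thesis
  proof (rule Bochner_Integration.integrable_bound)
    show "integrable lborel (\<lambda>y. B * g y)"
      using g by (simp add: integrable_pos_supp_def)
    have "\<bar>exp (- (x / y)) * y powr (- b) * g y\<bar> \<le> \<bar>B * g y\<bar>" for y
    proof (cases "y > 0")
      case True
      have "\<bar>exp (- (x / y)) * y powr (- b)\<bar> \<le> \<bar>B\<bar>"
        using B[OF True] by simp
      then show ?thesis
        unfolding abs_mult[of _ "g y"] by (rule mult_right_mono) simp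
    next
      case False
      then show ?thesis using g by (simp add: integrable_pos_supp_def)
    qed
    then show "AE y in lborel. norm (exp (- (x / y)) * y powr (- b) * g y) \<le> norm (B * g y)"
      by simp
  qed simp
qed

lemma integrable_pos_supp_abs: "integrable_pos_supp g \<Longrightarrow> integrable_pos_supp (\<lambda>y. \<bar>g y\<bar>)"
  by (simp add: integrable_pos_supp_def)

text \<open>The pointwise Taylor remainder of the exponential is integrated. Since \<open>h\<close>
  is at most half of \<open>x\<close> in modulus, its growth costs only half of the decay of
  \<open>exp (- (x / y))\<close>; the two powers of 1/y raise the index by 2.\<close>

lemma exp_transform_remainder:
  assumes g: "integrable_pos_supp g" and x: "0 < x" and b: "0 \<le> b" and h: "\<bar>h\<bar> \<le> x / 2"
  shows "\<bar>exp_transform b g (x + h) - exp_transform b g x + h * exp_transform (b + 1) g x\<bar>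
    \<le> h\<^sup>2 * exp_transform (b + 2) (\<lambda>y. \<bar>g y\<bar>) (x / 2)"
proof -
  have int: "integrable lborel (\<lambda>y. exp (- ((x + h) / y)) * y powr (- b) * g y)"
    "integrable lborel (\<lambda>y. exp (- (x / y)) * y powr (- b) * g y)"
    "integrable lborel (\<lambda>y. h * (exp (- (x / y)) * y powr (- (b + 1)) * g y))"
    using exp_transform_integrable[OF g, of "x + h" b] exp_transform_integrable[OF g, of x b]
      exp_transform_integrable[OF g, of x "b + 1"] x b h by auto
  let ?D = "\<lambda>y. exp (- ((x + h) / y)) * y powr (- b) * g y - exp (- (x / y)) * y powr (- b) * g y
      + h * (exp (- (x / y)) * y powr (- (b + 1)) * g y)"
  have bound: "\<bar>?D y\<bar> \<le> h\<^sup>2 * (exp (- ((x / 2) / y)) * y powr (- (b + 2)) * \<bar>g y\<bar>)" for y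
  proof (cases "y > 0")
    case True
    define z where "z = - (h / y)"
    note pw = powr_minus_add_one[OF True] powr_minus_add_two[OF True]
    have e: "exp (- ((x + h) / y)) = exp (- (x / y)) * exp z"
      by (simp add: z_def add_divide_distrib flip: exp_add)
    have "?D y = exp (- (x / y)) * (exp z - 1 - z) * y powr (- b) * g y"
      unfolding pw e by (simp add: z_def algebra_simps)
    then have "\<bar>?D y\<bar> = exp (- (x / y)) * \<bar>exp z - 1 - z\<bar> * (y powr (- b) * \<bar>g y\<bar>)"
      by (simp add: abs_mult)
    also have "\<dots> \<le> exp (- (x / y)) * (z\<^sup>2 * exp ((x / 2) / y)) * (y powr (- b) * \<bar>g y\<bar>)"
    proof (intro mult_right_mono mult_left_mono)
      have "\<bar>z\<bar> = \<bar>h\<bar> / y"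
        using True by (simp add: z_def)
      also have "\<dots> \<le> (x / 2) / y"
        using h True by (intro divide_right_mono) auto
      finally have "\<bar>z\<bar> \<le> (x / 2) / y" .
      then have "z\<^sup>2 * exp \<bar>z\<bar> \<le> z\<^sup>2 * exp ((x / 2) / y)"
        by (intro mult_left_mono) auto
      then show "\<bar>exp z - 1 - z\<bar> \<le> z\<^sup>2 * exp ((x / 2) / y)"
        using exp_minus_linear_bound[of z] by linarith
    qed auto
    also have "\<dots> = (exp (- (x / y)) * exp ((x / 2) / y)) * z\<^sup>2 * (y powr (- b) * \<bar>g y\<bar>)"
      by simp
    also have "exp (- (x / y)) * exp ((x / 2) / y) = exp (- ((x / 2) / y))"
      by (simp flip: exp_add)
    also have "exp (- ((x / 2) / y)) * z\<^sup>2 * (y powr (- b) * \<bar>g y\<bar>)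
        = h\<^sup>2 * (exp (- ((x / 2) / y)) * y powr (- (b + 2)) * \<bar>g y\<bar>)"
      unfolding pw by (simp add: z_def power_divide)
    finally show ?thesis .
  next
    case False
    then show ?thesis using g by (simp add: integrable_pos_supp_def)
  qed
  have eq: "exp_transform b g (x + h) - exp_transform b g x + h * exp_transform (b + 1) g x = (\<integral>y. ?D y \<partial>lborel)"
    unfolding exp_transform_def using int by (simp del: minus_add_distrib)
  have "(\<integral>y. \<bar>?D y\<bar> \<partial>lborel)
      \<le> (\<integral>y. h\<^sup>2 * (exp (- ((x / 2) / y)) * y powr (- (b + 2)) * \<bar>g y\<bar>) \<partial>lborel)"
    by (intro integral_mono bound integrable_mult_right exp_transform_integrable
        integrable_pos_supp_abs g integrable_abs Bochner_Integration.integrable_add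
        Bochner_Integration.integrable_diff int)
      (use x b in auto)
  then have "(\<integral>y. \<bar>?D y\<bar> \<partial>lborel) \<le> h\<^sup>2 * exp_transform (b + 2) (\<lambda>y. \<bar>g y\<bar>) (x / 2)"
    unfolding exp_transform_def by (simp only: integral_mult_right_zero)
  then show ?thesis
    unfolding eq by (rule order_trans[OF integral_abs_bound])
qed

text \<open>Division by \<open>h\<close> leaves an error of order \<open>h\<close> in the difference
  quotient.\<close>

lemma exp_transform_DERIV:
  assumes g: "integrable_pos_supp g" and x: "0 < x" and b: "0 \<le> b"
  shows "(exp_transform b g has_real_derivative - exp_transform (b + 1) g x) (at x)"
  unfolding DERIV_def
proof (rule LIM_zero_cancel, rule Lim_null_comparison)
  let ?K = "exp_transform (b + 2) (\<lambda>y. \<bar>g y\<bar>) (x / 2)"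
  show "((\<lambda>h. \<bar>h\<bar> * ?K) \<longlongrightarrow> 0) (at 0)"
    by (auto intro!: tendsto_eq_intros)
  have "eventually (\<lambda>h. \<bar>h\<bar> < x / 2 \<and> h \<noteq> 0) (at (0::real))"
    using x unfolding eventually_at by (intro exI[of _ "x / 2"]) (auto simp: dist_real_def)
  then show "eventually (\<lambda>h. norm ((exp_transform b g (x + h) - exp_transform b g x) / h
      - (- exp_transform (b + 1) g x)) \<le> \<bar>h\<bar> * ?K) (at 0)"
  proof eventually_elim
    case (elim h)
    then have "(exp_transform b g (x + h) - exp_transform b g x) / h - (- exp_transform (b + 1) g x)
        = (exp_transform b g (x + h) - exp_transform b g x + h * exp_transform (b + 1) g x) / h"
      by (simp add: field_simps)
    also have "\<bar>\<dots>\<bar> \<le> h\<^sup>2 * ?K / \<bar>h\<bar>"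
      unfolding abs_divide
      using exp_transform_remainder[OF g x b, of h] elim by (intro divide_right_mono) auto
    also have "\<dots> = \<bar>h\<bar> * ?K"
      using elim by (simp add: power2_eq_square abs_if)
    finally show ?case by simp
  qed
qed

section \<open>Partial integration on the whole line\<close>

text \<open>A nonzero limit would keep the modulus above a positive constant on a half-line of
  infinite measure.\<close>

lemma integrable_imp_limit_at_top_0:
  fixes H :: "real \<Rightarrow> real"
  assumes H: "integrable lborel H" and lim: "(H \<longlongrightarrow> l) at_top"
  shows "l = 0"
proof (rule ccontr)
  assume "l \<noteq> 0"
  have "eventually (\<lambda>x. dist (H x) l < \<bar>l\<bar> / 2) at_top"
    using lim \<open>l \<noteq> 0\<close> by (intro tendstoD) auto
  then obtain K where K: "\<And>x. x \<ge> K \<Longrightarrow> dist (H x) l < \<bar>l\<bar> / 2"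
    by (auto simp: eventually_at_top_linorder)
  have "integrable lborel (\<lambda>x. \<bar>l\<bar> / 2 * indicator {K..} x)"
  proof (rule Bochner_Integration.integrable_bound[OF H])
    have "\<bar>\<bar>l\<bar> / 2 * indicator {K..} x\<bar> \<le> \<bar>H x\<bar>" for x
    proof (cases "x \<ge> K")
      case True
      then show ?thesis
        using K[OF True] abs_triangle_ineq4[of "H x" "H x - l"] by (simp add: indicator_def dist_real_def)
    qed (simp add: indicator_def)
    then show "AE x in lborel. norm (\<bar>l\<bar> / 2 * indicator {K..} x) \<le> norm (H x)"
      by simp
  qed simp
  then have "integrable lborel (\<lambda>x. 2 / \<bar>l\<bar> * (\<bar>l\<bar> / 2 * indicator {K..} x))"
    by (rule integrable_mult_right)
  then have "integrable lborel (indicator {K..} :: real \<Rightarrow> real)"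
    using \<open>l \<noteq> 0\<close> by simp
  then have "emeasure lborel {K..} < \<infinity>"
    by (simp add: integrable_indicator_iff)
  then obtain r where r: "0 \<le> r" "emeasure lborel {K..} = ennreal r"
    by (cases "emeasure lborel {K..}") auto
  have "ennreal (r + 1) = emeasure lborel {K..K + (r + 1)}"
    using r by simp
  also have "\<dots> \<le> emeasure lborel {K..}"
    by (intro emeasure_mono) auto
  finally show False using r by simp
qed

text \<open>The integrals of \<open>G'\<close> over [-k, k] are \<open>H k = G k - G (- k)\<close>
  and converge to the full integral. As \<open>H\<close> is integrable, its limit is 0; no decay of
  \<open>G\<close> has to be known beforehand.\<close>

lemma integral_derivative_eq_0:
  fixes G G' :: "real \<Rightarrow> real"
  assumes deriv: "\<And>x. (G has_real_derivative G' x) (at x)"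
    and G: "integrable lborel G" and G': "integrable lborel G'"
  shows "(\<integral>x. G' x \<partial>lborel) = 0"
proof -
  define H where "H k = G k - G (- k)" for k
  have "integrable lborel (\<lambda>k. G (0 + (-1) * k))"
    by (rule lborel_integrable_real_affine[OF G]) simp
  then have "integrable lborel H"
    unfolding H_def using G by (intro Bochner_Integration.integrable_diff) auto
  moreover have "(H \<longlongrightarrow> (\<integral>x. G' x \<partial>lborel)) at_top"
  proof (rule Lim_transform_eventually)
    have [measurable]: "G' \<in> borel_measurable borel" using G' by auto
    show "((\<lambda>k. \<integral>x. indicator {-k..k} x * G' x \<partial>lborel) \<longlongrightarrow> (\<integral>x. G' x \<partial>lborel)) at_top"
    proof (rule integral_dominated_convergence_at_top[where w = "\<lambda>x. \<bar>G' x\<bar>"])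
      have "eventually (\<lambda>k. indicator {-k..k} x * G' x = G' x) at_top" for x
        using eventually_ge_at_top[of "\<bar>x\<bar>"] by eventually_elim (auto simp: indicator_def)
      then show "AE x in lborel. ((\<lambda>k. indicator {-k..k} x * G' x) \<longlongrightarrow> G' x) at_top"
        by (intro AE_I2 tendsto_eventually)
      show "eventually (\<lambda>k. AE x in lborel. norm (indicator {-k..k} x * G' x) \<le> \<bar>G' x\<bar>) at_top"
        by (auto simp: indicator_def)
    qed (use G' in auto)
    have "(\<integral>x. indicator {-k..k} x * G' x \<partial>lborel) = H k" if "k \<ge> 0" for k
    proof -
      \<comment> \<open>The fundamental theorem for the gauge integral accepts a discontinuous
        \<open>G'\<close>; integrability then identifies this with the Lebesgue integral.\<close>
      have "(G' has_integral (G k - G (- k))) {-k..k}"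
        using that deriv by (intro fundamental_theorem_of_calculus)
          (auto simp: has_real_derivative_iff_has_vector_derivative intro: has_vector_derivative_at_within)
      moreover have "set_integrable lborel {-k..k} G'"
        unfolding set_integrable_def using integrable_mult_indicator[OF _ G', of "{-k..k}"] by simp
      from set_borel_integral_eq_integral[OF this]
      have "(G' has_integral (LINT x:{-k..k}|lborel. G' x)) {-k..k}"
        by (simp add: integrable_integral)
      ultimately show ?thesis
        by (auto simp: H_def set_lebesgue_integral_def dest: has_integral_unique)
    qed
    then show "eventually (\<lambda>k. (\<integral>x. indicator {-k..k} x * G' x \<partial>lborel) = H k) at_top"
      by (rule eventually_mono[OF eventually_ge_at_top[of "0::real"]])
  qed
  ultimately show ?thesis by (rule integrable_imp_limit_at_top_0)
qed

text \<open>The kernel times \<open>g\<close> is integrable and differentiable on the whole line, so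
  its derivative integrates to 0. Differentiating the kernel in \<open>y\<close> gives the two terms
  on the right.\<close>

lemma exp_transform_by_parts:
  assumes g: "integrable_pos_supp g" and g': "integrable_pos_supp g'"
    and deriv: "\<And>y. (g has_real_derivative g' y) (at y)" and x: "0 < x" and b: "0 \<le> b"
  shows "exp_transform b g' x = b * exp_transform (b + 1) g x - x * exp_transform (b + 2) g x"
proof -
  define k where "k y = exp (- (x / y)) * y powr (- b)" for y
  define G where "G y = k y * g y" for y
  define G' where "G' y = x * (exp (- (x / y)) * y powr (- (b + 2)) * g y)
    - b * (exp (- (x / y)) * y powr (- (b + 1)) * g y) + k y * g' y" for y
  have int: "integrable lborel (\<lambda>y. exp (- (x / y)) * y powr (- (b + 2)) * g y)"
    "integrable lborel (\<lambda>y. exp (- (x / y)) * y powr (- (b + 1)) * g y)"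
    "integrable lborel (\<lambda>y. k y * g' y)" "integrable lborel G"
    unfolding k_def G_def
    using exp_transform_integrable[OF g x, of "b + 2"] exp_transform_integrable[OF g x, of "b + 1"]
      exp_transform_integrable[OF g x b] exp_transform_integrable[OF g' x b] b
    by auto
  have zero: "g y = 0" "g' y = 0" if "y \<le> 0" for y
    using g g' that by (auto simp: integrable_pos_supp_def)
  have "(\<integral>y. G' y \<partial>lborel) = 0"
  proof (rule integral_derivative_eq_0[of G])
    show "integrable lborel G'"
      unfolding G'_def using int by auto
    show "(G has_real_derivative G' y) (at y)" for y
    proof -
      consider "y > 0" | "y < 0" | "y = 0" by linarith
      then show ?thesis
      proof cases
        case 1
        have "(G has_real_derivative (exp (- (x / y)) * (x / y\<^sup>2) * y powr (- b)
            + exp (- (x / y)) * (- b * y powr (- b - 1))) * g y + k y * g' y) (at y)"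
          unfolding G_def k_def using 1
          by (auto intro!: derivative_eq_intros deriv has_real_derivative_powr simp: power2_eq_square)
        also have "(exp (- (x / y)) * (x / y\<^sup>2) * y powr (- b)
            + exp (- (x / y)) * (- b * y powr (- b - 1))) * g y + k y * g' y = G' y"
        proof -
          have "y powr (- b - 1) = y powr (- b) / y" "y powr (- b - 2) = y powr (- b) / y\<^sup>2"
            using powr_minus_add_one[OF 1, of b] powr_minus_add_two[OF 1, of b] by simp_all
          then show ?thesis
            by (simp add: G'_def) (simp add: algebra_simps)
        qed
        finally show ?thesis .
      next
        case 2
        have "((\<lambda>_. 0) has_real_derivative 0) (at y)" by simp
        then have "(G has_real_derivative 0) (at y)"
          by (rule has_field_derivative_transform_within_open[where S = "{..<0}"])
            (use 2 in \<open>auto simp: G_def zero\<close>)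
        then show ?thesis using 2 by (simp add: G'_def zero)
      next
        case 3
        \<comment> \<open>At the origin the difference quotient from the right is the bounded kernel
          of index \<open>b + 1\<close> times \<open>g h\<close>, and \<open>g h\<close> tends to 0
          by continuity.\<close>
        obtain B where B: "B \<ge> 0" "\<And>y. y > 0 \<Longrightarrow> exp (- (x / y)) * y powr (- (b + 1)) \<le> B"
          using exp_kernel_bounded[OF x, of "b + 1"] b by auto
        have "((\<lambda>h. (G (0 + h) - G 0) / h) \<longlongrightarrow> 0) (at 0)"
        proof (rule Lim_null_comparison)
          have "isCont g 0" using deriv[of 0] by (rule DERIV_isCont)
          then have "(g \<longlongrightarrow> 0) (at 0)" by (simp add: isCont_def zero)
          then show "((\<lambda>h. B * \<bar>g h\<bar>) \<longlongrightarrow> 0) (at 0)"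
            by (auto intro!: tendsto_eq_intros)
          have "\<bar>G h / h\<bar> \<le> B * \<bar>g h\<bar>" if "h \<noteq> 0" for h
          proof (cases "h > 0")
            case True
            have "G h / h = exp (- (x / h)) * h powr (- (b + 1)) * g h"
              using powr_minus_add_one[OF True, of b] by (simp add: G_def k_def)
            then show ?thesis
              using B(2)[OF True] by (simp add: abs_mult mult_right_mono)
          qed (use B that in \<open>auto simp: G_def zero\<close>)
          then show "eventually (\<lambda>h. norm ((G (0 + h) - G 0) / h) \<le> B * \<bar>g h\<bar>) (at 0)"
            by (auto simp: eventually_at G_def zero intro!: exI[of _ 1])
        qed
        then show ?thesis using 3 by (simp add: DERIV_def G'_def zero)
      qed
    qed
  qed (rule int)
  moreover have "(\<integral>y. G' y \<partial>lborel) = x * exp_transform (b + 2) g x - b * exp_transform (b + 1) g x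
      + exp_transform b g' x"
    unfolding G'_def exp_transform_def k_def[symmetric] using int by simp
  ultimately show ?thesis by simp
qed

section \<open>Moments and boundary behaviour of the transform\<close>

text \<open>Euler's integral after the substitution \<open>x = y * t\<close>.\<close>

lemma has_bochner_integral_Gamma:
  fixes p y :: real
  assumes "p > 0" "y > 0"
  shows "has_bochner_integral lborel (\<lambda>x. indicator {0<..} x * (x powr (p - 1) * exp (- (x / y)))) (y powr p * Gamma p)"
proof -
  let ?f = "\<lambda>t. indicator {0<..} t * (t powr (p - 1) * exp (- t))"
  have "((\<lambda>t. t powr (p - 1) / exp t) has_integral Gamma p) {0..}"
    using assms by (intro Gamma_integral_real) auto
  then have closed: "((\<lambda>t. t powr (p - 1) * exp (- t)) has_integral Gamma p) {0..}"
    by (simp only: exp_minus divide_inverse)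
  have neg1: "negligible {t \<in> {0..} - {0<..}. t powr (p - 1) * exp (- t) \<noteq> 0}"
    by (rule negligible_subset[of "{0}"]) auto
  have neg2: "negligible {t \<in> {0<..} - {0..}. t powr (p - 1) * exp (- t) \<noteq> (0::real)}"
    by (rule negligible_subset[of "{}"]) auto
  \<comment> \<open>Dropping the endpoint 0 leaves the gauge integral unchanged; nonnegativity then
    makes it a Lebesgue integral.\<close>
  have Gamma: "((\<lambda>t. t powr (p - 1) * exp (- t)) has_integral Gamma p) {0<..}"
    by (rule has_integral_spike_set_eq[OF neg1 neg2, THEN iffD1, OF closed])
  then have "(\<lambda>t. t powr (p - 1) * exp (- t)) absolutely_integrable_on {0<..}"
    by (intro nonnegative_absolutely_integrable_1) auto
  then have int: "set_integrable lborel {0<..} (\<lambda>t. t powr (p - 1) * exp (- t))"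
    unfolding set_integrable_def by (subst (asm) integrable_completion) auto
  then have *: "has_bochner_integral lborel ?f (Gamma p)"
    using int set_borel_integral_eq_integral(2)[OF int] integral_unique[OF Gamma]
    by (simp add: has_bochner_integral_iff set_integrable_def set_lebesgue_integral_def)
  have "has_bochner_integral lborel (\<lambda>x. ?f (0 + inverse y * x)) (Gamma p / \<bar>inverse y\<bar>)"
    using lborel_has_bochner_integral_real_affine_iff[of "inverse y" ?f "Gamma p" 0] * assms
    by (simp add: divide_inverse mult.commute)
  then have "has_bochner_integral lborel (\<lambda>x. y powr (p - 1) * ?f (0 + inverse y * x)) (y powr (p - 1) * (Gamma p / \<bar>inverse y\<bar>))"
    by (rule has_bochner_integral_mult_right)
  also have "y powr (p - 1) * (Gamma p / \<bar>inverse y\<bar>) = y powr p * Gamma p"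
    using assms powr_add[of y "p - 1" 1] by (simp add: divide_inverse)
  also have "(\<lambda>x. y powr (p - 1) * ?f (0 + inverse y * x)) = (\<lambda>x. indicator {0<..} x * (x powr (p - 1) * exp (- (x / y))))"
    using assms by (auto simp: fun_eq_iff indicator_def zero_less_mult_iff divide_inverse mult_ac powr_mult inverse_powr powr_minus)
  finally show ?thesis .
qed

text \<open>Fubini's theorem: integrating the kernel over \<open>x\<close> first gives a Gamma
  integral, whose factor \<open>y powr p\<close> combines with \<open>y powr (- b)\<close>.\<close>

lemma exp_transform_moment:
  assumes g: "integrable_pos_supp g" and p: "p > 0" and b: "b \<ge> 0"
    and int: "integrable lborel (\<lambda>y. y powr (p - b) * g y)"
  shows "has_bochner_integral lborel (\<lambda>x. indicator {0<..} x * (x powr (p - 1) * exp_transform b g x))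
    (Gamma p * (\<integral>y. y powr (p - b) * g y \<partial>lborel))"
proof -
  have [measurable]: "g \<in> borel_measurable borel"
    using g by (auto simp: integrable_pos_supp_def)
  let ?f = "\<lambda>y x. indicator {0<..} x * (x powr (p - 1) * exp (- (x / y))) * (y powr (- b) * g y)"
  have inner: "has_bochner_integral lborel (\<lambda>x. ?f y x) (Gamma p * (y powr (p - b) * g y))"
    and inner_norm: "(\<integral>x. norm (?f y x) \<partial>lborel) = Gamma p * \<bar>y powr (p - b) * g y\<bar>" for y
  proof -
    \<comment> \<open>The free factor \<open>v\<close> stands for \<open>g y\<close> and also for
      its modulus, which gives the integral of the norm.\<close>
    have A: "has_bochner_integral lborel (\<lambda>x. indicator {0<..} x * (x powr (p - 1) * exp (- (x / y))) * (y powr (- b) * v))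
        (Gamma p * (y powr (p - b) * v))" if "y > 0" for v
      using has_bochner_integral_mult_left[OF has_bochner_integral_Gamma[OF p that], of "y powr (- b) * v"]
      using powr_add[of y p "- b"] by (simp add: mult_ac)
    show "has_bochner_integral lborel (\<lambda>x. ?f y x) (Gamma p * (y powr (p - b) * g y))"
    proof (cases "y > 0")
      case False
      then show ?thesis
        using g has_bochner_integral_zero by (simp add: integrable_pos_supp_def)
    qed (rule A)
    show "(\<integral>x. norm (?f y x) \<partial>lborel) = Gamma p * \<bar>y powr (p - b) * g y\<bar>"
    proof (cases "y > 0")
      case False
      then show ?thesis using g by (simp add: integrable_pos_supp_def)
    next
      case True
      then show ?thesis
        using has_bochner_integral_integral_eq[OF A[OF True, of "\<bar>g y\<bar>"]] by (simp add: abs_mult)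
    qed
  qed
  have prod: "integrable (lborel \<Otimes>\<^sub>M lborel) (\<lambda>(y, x). ?f y x)"
  proof (rule lborel_pair.Fubini_integrable)
    show "integrable lborel (\<lambda>y. \<integral>x. norm (case (y, x) of (y, x) \<Rightarrow> ?f y x) \<partial>lborel)"
      unfolding prod.case inner_norm by (intro integrable_mult_right integrable_abs int)
    show "AE y in lborel. integrable lborel (\<lambda>x. case (y, x) of (y, x) \<Rightarrow> ?f y x)"
      unfolding prod.case using inner by (auto simp: has_bochner_integral_iff)
  qed simp
  have eq: "(\<integral>y. ?f y x \<partial>lborel) = indicator {0<..} x * (x powr (p - 1) * exp_transform b g x)" for x
    by (simp add: exp_transform_def mult.assoc)
  show ?thesis
  proof (rule has_bochner_integral_iff[THEN iffD2], rule conjI)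
    show "integrable lborel (\<lambda>x. indicator {0<..} x * (x powr (p - 1) * exp_transform b g x))"
      using lborel_pair.integrable_snd[OF prod] by (simp only: eq)
    have "(\<integral>x. (\<integral>y. ?f y x \<partial>lborel) \<partial>lborel) = (\<integral>y. (\<integral>x. ?f y x \<partial>lborel) \<partial>lborel)"
      by (rule lborel_pair.Fubini_integral[OF prod])
    also have "\<dots> = Gamma p * (\<integral>y. y powr (p - b) * g y \<partial>lborel)"
      by (simp only: has_bochner_integral_integral_eq[OF inner] integral_mult_right_zero)
    finally show "(\<integral>x. indicator {0<..} x * (x powr (p - 1) * exp_transform b g x) \<partial>lborel)
        = Gamma p * (\<integral>y. y powr (p - b) * g y \<partial>lborel)"
      by (simp only: eq)
  qed
qed

text \<open>The integrand is (x/y)^b exp(-x/y) times g(y)/y. The first part is bounded uniformly and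
  tends to 0 for fixed y > 0, while g(y)/y is integrable because \<open>g\<close> vanishes to first
  order at 0; dominated convergence applies.\<close>

lemma exp_transform_boundary:
  assumes g: "integrable_pos_supp g" and deriv: "(g has_real_derivative 0) (at 0)" and b: "b > 0"
  shows "((\<lambda>x. x powr b * exp_transform (b + 1) g x) \<longlongrightarrow> 0) (at_right 0)"
proof -
  have [measurable]: "g \<in> borel_measurable borel"
    using g by (auto simp: integrable_pos_supp_def)
  have zero: "g y = 0" if "y \<le> 0" for y
    using g that by (auto simp: integrable_pos_supp_def)
  have "((\<lambda>y. g y / y) \<longlongrightarrow> 0) (at 0)"
    using deriv by (simp add: DERIV_def zero)
  then have "eventually (\<lambda>y. dist (g y / y) 0 < 1) (at 0)"
    by (rule tendstoD) simp
  then obtain \<delta> where "\<delta> > 0" and \<delta>: "\<And>y. y \<noteq> 0 \<Longrightarrow> \<bar>y\<bar> < \<delta> \<Longrightarrow> \<bar>g y / y\<bar> < 1"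
    unfolding eventually_at by (auto simp: dist_real_def)
  have quot: "integrable lborel (\<lambda>y. g y / y)"
  proof (rule Bochner_Integration.integrable_bound)
    \<comment> \<open>Below \<open>\<delta>\<close> the quotient is at most 1 in modulus, beyond it
      the denominator is at least \<open>\<delta>\<close>.\<close>
    show "integrable lborel (\<lambda>y. indicator {0..\<delta>} y + \<bar>g y\<bar> / \<delta>)"
      using g by (intro Bochner_Integration.integrable_add integrable_divide integrable_abs)
        (auto simp: integrable_pos_supp_def emeasure_lborel_Icc_eq intro!: integrable_real_indicator)
    have "\<bar>g y / y\<bar> \<le> indicator {0..\<delta>} y + \<bar>g y\<bar> / \<delta>" for y
    proof -
      consider "y \<le> 0" | "0 < y" "y < \<delta>" | "\<delta> \<le> y" by linarith
      then show ?thesis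
      proof cases
        case 1
        then show ?thesis using \<open>\<delta> > 0\<close> by (simp add: zero)
      next
        case 2
        then have "\<bar>g y / y\<bar> \<le> 1" using \<delta>[of y] by simp
        moreover have "0 \<le> \<bar>g y\<bar> / \<delta>" using \<open>\<delta> > 0\<close> by simp
        moreover have "indicator {0..\<delta>} y = (1::real)" using 2 by simp
        ultimately show ?thesis by linarith
      next
        case 3
        then have "\<bar>g y\<bar> / y \<le> \<bar>g y\<bar> / \<delta>"
          using \<open>\<delta> > 0\<close> by (intro divide_left_mono) auto
        moreover have "\<bar>g y / y\<bar> = \<bar>g y\<bar> / y"
          using 3 \<open>\<delta> > 0\<close> by (simp add: abs_divide)
        moreover have "indicator {0..\<delta>} y \<ge> (0::real)" by simp
        ultimately show ?thesis by linarith
      qed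
    qed
    then show "AE y in lborel. norm (g y / y) \<le> norm (indicator {0..\<delta>} y + \<bar>g y\<bar> / \<delta>)"
      unfolding real_norm_def by (intro AE_I2 order_trans[OF _ abs_ge_self])
  qed simp
  obtain B where B: "B \<ge> 0" "\<And>u. u > 0 \<Longrightarrow> u powr b * exp (- u) \<le> B"
    using powr_mult_exp_bounded[of b 1] b by auto
  define F where "F x y = (x / y) powr b * exp (- (x / y)) * (g y / y)" for x y
  have bound: "\<bar>F x y\<bar> \<le> B * \<bar>g y / y\<bar>" if "x > 0" for x y
  proof (cases "y > 0")
    case True
    then have "(x / y) powr b * exp (- (x / y)) \<le> B"
      using B(2)[of "x / y"] that by simp
    then show ?thesis
      unfolding F_def abs_mult[of _ "g y / y"] by (intro mult_right_mono) auto
  qed (simp add: F_def zero)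
  \<comment> \<open>The substitution x = 1/t turns the limit at 0 from the right into a limit at
    infinity.\<close>
  have "((\<lambda>t. \<integral>y. F (inverse t) y \<partial>lborel) \<longlongrightarrow> integral\<^sup>L lborel (\<lambda>y::real. 0)) at_top"
  proof (rule integral_dominated_convergence_at_top[where w = "\<lambda>y. B * \<bar>g y / y\<bar>"])
    show "integrable lborel (\<lambda>y. B * \<bar>g y / y\<bar>)"
      using quot by (intro integrable_mult_right integrable_abs)
    show "eventually (\<lambda>t. AE y in lborel. norm (F (inverse t) y) \<le> B * \<bar>g y / y\<bar>) at_top"
      using eventually_gt_at_top[of "0::real"]
    proof eventually_elim
      case (elim t)
      then show ?case using bound[of "inverse t"] by (intro AE_I2) simp
    qed
    have "((\<lambda>t. F (inverse t) y) \<longlongrightarrow> 0) at_top" for y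
    proof (cases "y > 0")
      case True
      have "((\<lambda>t. inverse t / y) \<longlongrightarrow> 0) at_top"
        using tendsto_divide[OF tendsto_inverse_0_at_top[OF filterlim_ident] tendsto_const[of y]] True by simp
      moreover from this have "((\<lambda>t. (inverse t / y) powr b) \<longlongrightarrow> 0) at_top"
        using b True by (intro tendsto_zero_powrI[OF _ tendsto_const])
          (auto intro: eventually_mono[OF eventually_gt_at_top[of 0]])
      ultimately have "((\<lambda>t. (inverse t / y) powr b * exp (- (inverse t / y)) * (g y / y)) \<longlongrightarrow> 0 * exp (- 0) * (g y / y)) at_top"
        by (intro tendsto_intros)
      then show ?thesis by (simp add: F_def)
    qed (simp add: F_def zero)
    then show "AE y in lborel. ((\<lambda>t. F (inverse t) y) \<longlongrightarrow> 0) at_top" by simp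
  qed (auto simp: F_def)
  then have "((\<lambda>x. \<integral>y. F x y \<partial>lborel) \<longlongrightarrow> 0) (at_right 0)"
    by (simp add: filterlim_at_right_to_top)
  moreover have "eventually (\<lambda>x. (\<integral>y. F x y \<partial>lborel) = x powr b * exp_transform (b + 1) g x) (at_right 0)"
    using eventually_at_right_less[of "0::real"]
  proof eventually_elim
    case (elim x)
    have "F x y = x powr b * (exp (- (x / y)) * y powr (- (b + 1)) * g y)" for y
    proof (cases "y > 0")
      case True
      then show ?thesis
        using elim powr_minus_add_one[OF True, of b] by (simp add: F_def powr_divide powr_minus_divide)
    qed (simp add: F_def zero)
    then show ?case
      by (simp add: exp_transform_def)
  qed
  ultimately show ?thesis by (rule Lim_transform_eventually)
qed

section \<open>Action of the differential operators on the transform\<close>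

lemma deriv_eqI:
  fixes f g :: "real \<Rightarrow> real"
  assumes "(g has_real_derivative D) (at x)" "x > 0" "\<And>t. t > 0 \<Longrightarrow> f t = g t"
  shows "(f has_real_derivative D) (at x)" "deriv f x = D"
proof -
  show "(f has_real_derivative D) (at x)"
    by (rule has_field_derivative_transform_within_open[OF assms(1), where S = "{0<..}"]) (use assms in auto)
  then show "deriv f x = D" by (rule DERIV_imp_deriv)
qed

text \<open>The inner power cancels the prefactor, so the derivative meets only the transform and
  raises its index by one.\<close>

lemma bdry_op_exp_transform:
  assumes g: "integrable_pos_supp g" and \<nu>: "\<nu> > -1" and x: "x > 0"
    and f: "\<And>t. t > 0 \<Longrightarrow> f t = k * t powr \<nu> * exp_transform (\<nu> + 1) g t"
  shows "bdry_op \<nu> f x = - k * x powr (\<nu> + 1) * exp_transform (\<nu> + 2) g x"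
proof -
  have "(exp_transform (\<nu> + 1) g has_real_derivative - exp_transform (\<nu> + 2) g x) (at x)"
    using exp_transform_DERIV[OF g x, of "\<nu> + 1"] \<nu> by (simp add: add.assoc)
  then have "((\<lambda>t. k * exp_transform (\<nu> + 1) g t) has_real_derivative k * (- exp_transform (\<nu> + 2) g x)) (at x)"
    by (rule DERIV_cmult)
  then have "deriv (\<lambda>t. 1 / t powr \<nu> * f t) x = k * (- exp_transform (\<nu> + 2) g x)"
    by (rule deriv_eqI) (use x f in auto)
  then show ?thesis by (simp add: bdry_op_def)
qed

text \<open>The product rule produces exactly the right-hand side of partial integration at index
  \<open>\<nu> + 1\<close>. The form of \<open>f\<close> is thus reproduced with \<open>- k\<close>
  and \<open>g'\<close>.\<close>

lemma bdry_op_exp_transform_DERIV: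
  assumes g: "integrable_pos_supp g" "integrable_pos_supp g'"
    and deriv: "\<And>y. (g has_real_derivative g' y) (at y)" and \<nu>: "\<nu> > -1" and x: "x > 0"
    and f: "\<And>t. t > 0 \<Longrightarrow> f t = k * t powr \<nu> * exp_transform (\<nu> + 1) g t"
  shows "deriv (bdry_op \<nu> f) x = - k * x powr \<nu> * exp_transform (\<nu> + 1) g' x"
proof (rule deriv_eqI)
  let ?L = "\<lambda>i. exp_transform (\<nu> + i) g"
  have L: "(?L 2 has_real_derivative - ?L 3 x) (at x)"
    using exp_transform_DERIV[OF g(1) x, of "\<nu> + 2"] \<nu> by (simp add: add.assoc)
  have "((\<lambda>t. - k * t powr (\<nu> + 1) * ?L 2 t) has_real_derivative
      - k * ((\<nu> + 1) * x powr \<nu>) * ?L 2 x - k * x powr (\<nu> + 1) * (- ?L 3 x)) (at x)"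
    using x L by (auto intro!: derivative_eq_intros)
  also have "- k * ((\<nu> + 1) * x powr \<nu>) * ?L 2 x - k * x powr (\<nu> + 1) * (- ?L 3 x)
      = - k * x powr \<nu> * ((\<nu> + 1) * ?L 2 x - x * ?L 3 x)"
    using x by (simp add: powr_add algebra_simps)
  also have "(\<nu> + 1) * ?L 2 x - x * ?L 3 x = exp_transform (\<nu> + 1) g' x"
    using exp_transform_by_parts[OF g deriv x, of "\<nu> + 1"] \<nu> by (simp add: add.assoc)
  finally show "((\<lambda>t. - k * t powr (\<nu> + 1) * ?L 2 t) has_real_derivative
      - k * x powr \<nu> * exp_transform (\<nu> + 1) g' x) (at x)" .
qed (use x bdry_op_exp_transform[OF g(1) \<nu> _ f] in auto)

text \<open>The other factorization of the same operator, evaluated from the inside; partial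
  integration at index \<open>\<nu> + 1\<close> closes the computation again.\<close>

lemma weight_op_exp_transform:
  assumes g: "integrable_pos_supp g" "integrable_pos_supp g'"
    and deriv: "\<And>y. (g has_real_derivative g' y) (at y)" and \<nu>: "\<nu> > -1" and x: "x > 0"
    and f: "\<And>t. t > 0 \<Longrightarrow> f t = k * t powr \<nu> * exp_transform (\<nu> + 1) g t"
  shows "weight_op \<nu> f x = - k * x powr \<nu> * exp_transform (\<nu> + 1) g' x"
proof -
  let ?L = "\<lambda>i. exp_transform (\<nu> + i) g"
  have L: "(?L 1 has_real_derivative - ?L 2 t) (at t)" "(?L 2 has_real_derivative - ?L 3 t) (at t)"
    if "t > 0" for t
    using exp_transform_DERIV[OF g(1) that, of "\<nu> + 1"] exp_transform_DERIV[OF g(1) that, of "\<nu> + 2"] \<nu>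
    by (simp_all add: add.assoc)
  have d: "deriv f t = k * (\<nu> * t powr (\<nu> - 1) * ?L 1 t - t powr \<nu> * ?L 2 t)" if "t > 0" for t
  proof (rule deriv_eqI(2)[OF _ that f])
    show "((\<lambda>t. k * t powr \<nu> * ?L 1 t) has_real_derivative
        k * (\<nu> * t powr (\<nu> - 1) * ?L 1 t - t powr \<nu> * ?L 2 t)) (at t)"
      using that L(1)[OF that]
      by (auto intro!: derivative_eq_intros has_real_derivative_powr simp: algebra_simps)
  qed
  have inner: "1 / t powr (\<nu> - 1) * deriv f t = k * (\<nu> * ?L 1 t - t * ?L 2 t)" if "t > 0" for t
  proof -
    have pw: "t powr \<nu> = t powr (\<nu> - 1) * t"
      using that powr_add[of t "\<nu> - 1" 1] by simp
    have "deriv f t = t powr (\<nu> - 1) * (k * (\<nu> * ?L 1 t - t * ?L 2 t))"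
      unfolding d[OF that] pw by (simp add: algebra_simps)
    then show ?thesis using that by simp
  qed
  have "deriv (\<lambda>t. 1 / t powr (\<nu> - 1) * deriv f t) x = k * (\<nu> * (- ?L 2 x) - (?L 2 x + x * (- ?L 3 x)))"
  proof (rule deriv_eqI(2)[OF _ x inner])
    show "((\<lambda>t. k * (\<nu> * ?L 1 t - t * ?L 2 t)) has_real_derivative
        k * (\<nu> * (- ?L 2 x) - (?L 2 x + x * (- ?L 3 x)))) (at x)"
      using L[OF x] by (auto intro!: derivative_eq_intros)
  qed
  also have "\<dots> = - k * ((\<nu> + 1) * ?L 2 x - x * ?L 3 x)"
    by (simp add: algebra_simps)
  also have "(\<nu> + 1) * ?L 2 x - x * ?L 3 x = exp_transform (\<nu> + 1) g' x"
    using exp_transform_by_parts[OF g deriv x, of "\<nu> + 1"] \<nu> by (simp add: add.assoc)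
  finally show ?thesis
    unfolding weight_op_def by simp
qed

text \<open>A single induction for both operators: each application of \<open>Op\<close> flips the
  sign and passes from \<open>W j\<close> to \<open>W (Suc j)\<close>.\<close>

lemma iterate_exp_transform:
  assumes step: "\<And>f g g' k x. integrable_pos_supp g \<Longrightarrow> integrable_pos_supp g' \<Longrightarrow>
      (\<And>y. (g has_real_derivative g' y) (at y)) \<Longrightarrow> x > 0 \<Longrightarrow>
      (\<And>t. t > 0 \<Longrightarrow> f t = k * t powr \<nu> * exp_transform (\<nu> + 1) g t) \<Longrightarrow>
      Op f x = - k * x powr \<nu> * exp_transform (\<nu> + 1) g' x"
    and W: "\<And>j. j < n \<Longrightarrow> integrable_pos_supp (W j)"
      "\<And>j y. Suc j < n \<Longrightarrow> (W j has_real_derivative W (Suc j) y) (at y)"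
    and \<omega>: "\<And>x. x > 0 \<Longrightarrow> \<omega> x = k * x powr \<nu> * exp_transform (\<nu> + 1) (W 0) x"
    and "j < n" "x > 0"
  shows "(Op ^^ j) \<omega> x = (-1) ^ j * k * x powr \<nu> * exp_transform (\<nu> + 1) (W j) x"
  using \<open>j < n\<close> \<open>x > 0\<close>
proof (induction j arbitrary: x)
  case 0
  then show ?case by (simp add: \<omega>)
next
  case (Suc j)
  have "Op ((Op ^^ j) \<omega>) x = - ((-1) ^ j * k) * x powr \<nu> * exp_transform (\<nu> + 1) (W (Suc j)) x"
    by (rule step[of "W j"]) (use Suc W in auto)
  then show ?case by simp
qed

section \<open>Smoothness of the transform\<close>

text \<open>A class of functions closed under differentiation: by the product rule the derivative of
  a generator is a sum of two generators. Membership therefore passes to derivatives of every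
  order.\<close>

inductive exp_transform_span :: "(real \<Rightarrow> real) \<Rightarrow> (real \<Rightarrow> real) \<Rightarrow> bool" for g where
  base: "b \<ge> 0 \<Longrightarrow> exp_transform_span g (\<lambda>x. c * x powr a * exp_transform b g x)"
| sum: "exp_transform_span g f1 \<Longrightarrow> exp_transform_span g f2 \<Longrightarrow> exp_transform_span g (\<lambda>x. f1 x + f2 x)"

lemma exp_transform_span_DERIV:
  assumes "exp_transform_span g f" "integrable_pos_supp g"
  shows "\<exists>f'. exp_transform_span g f' \<and> (\<forall>x>0. (f has_real_derivative f' x) (at x))"
  using assms
proof (induction rule: exp_transform_span.induct)
  case (base b c a)
  let ?f' = "\<lambda>x. c * a * x powr (a - 1) * exp_transform b g x + (- c) * x powr a * exp_transform (b + 1) g x"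
  have "exp_transform_span g ?f'"
    using base by (intro exp_transform_span.intros) auto
  moreover have "((\<lambda>x. c * x powr a * exp_transform b g x) has_real_derivative ?f' x) (at x)" if "x > 0" for x
    using that exp_transform_DERIV[OF base(2) that base(1)]
    by (auto intro!: derivative_eq_intros has_real_derivative_powr simp: algebra_simps)
  ultimately show ?case by blast
next
  case (sum f1 f2)
  then obtain f1' f2' where "exp_transform_span g f1'" "exp_transform_span g f2'"
    "\<And>x. x > 0 \<Longrightarrow> (f1 has_real_derivative f1' x) (at x)" "\<And>x. x > 0 \<Longrightarrow> (f2 has_real_derivative f2' x) (at x)"
    by blast
  then show ?case
    by (intro exI[of _ "\<lambda>x. f1' x + f2' x"]) (auto intro: exp_transform_span.sum DERIV_add)
qed

lemma exp_transform_times_differentiable: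
  assumes g: "integrable_pos_supp g" and b: "b \<ge> 0"
    and F: "\<And>x. x > 0 \<Longrightarrow> F x = c * x powr a * exp_transform b g x"
  shows "times_differentiable_on m F {0<..}"
proof -
  have span: "\<exists>f. exp_transform_span g f \<and> (\<forall>x>0. (deriv ^^ j) F x = f x)" for j
  proof (induction j)
    case 0
    show ?case using F b by (auto intro: exp_transform_span.base)
  next
    case (Suc j)
    then obtain f where f: "exp_transform_span g f" "\<And>x. x > 0 \<Longrightarrow> (deriv ^^ j) F x = f x"
      by blast
    obtain f' where f': "exp_transform_span g f'" "\<And>x. x > 0 \<Longrightarrow> (f has_real_derivative f' x) (at x)"
      using exp_transform_span_DERIV[OF f(1) g] by blast
    have "(deriv ^^ Suc j) F x = f' x" if "x > 0" for x
      using deriv_eqI(2)[OF f'(2)[OF that] that f(2)] by simp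
    with f'(1) show ?case by blast
  qed
  have "(deriv ^^ j) F differentiable_on {0<..}" for j
  proof -
    obtain f where f: "exp_transform_span g f" "\<And>x. x > 0 \<Longrightarrow> (deriv ^^ j) F x = f x"
      using span[of j] by blast
    obtain f' where f': "\<And>x. x > 0 \<Longrightarrow> (f has_real_derivative f' x) (at x)"
      using exp_transform_span_DERIV[OF f(1) g] by blast
    have "(deriv ^^ j) F differentiable (at x)" if "x > 0" for x
      using deriv_eqI(1)[OF f'[OF that] that f(2)] real_differentiable_def by blast
    then show ?thesis
      by (auto simp: differentiable_on_def intro: differentiable_at_withinI)
  qed
  then show ?thesis by (simp add: times_differentiable_on_def)
qed

section \<open>Derivatives and moments of the mixing function\<close>

text \<open>At a point of the closed negative half-line the derivative can be computed from the
  left, where the function is constantly 0.\<close>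

lemma derivatives_vanish:
  fixes W :: "nat \<Rightarrow> real \<Rightarrow> real"
  assumes W: "\<And>j y. Suc j < n \<Longrightarrow> (W j has_real_derivative W (Suc j) y) (at y)"
    and W0: "\<And>y. y \<le> 0 \<Longrightarrow> W 0 y = 0" and "j < n" "y \<le> 0"
  shows "W j y = 0"
  using \<open>j < n\<close> \<open>y \<le> 0\<close>
proof (induction j arbitrary: y)
  case 0
  then show ?case by (simp add: W0)
next
  case (Suc j)
  have "(W j has_real_derivative W (Suc j) y) (at_left y)"
    by (rule has_field_derivative_at_within[OF W]) (use Suc.prems in simp)
  moreover have zero: "W j t = 0" if "t \<le> y" for t
    by (rule Suc.IH) (use that Suc.prems in auto)
  have "eventually (\<lambda>t. W j t = 0) (at_left y)"
    by (rule eventually_at_leftI[of "y - 1"]) (auto intro: zero)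
  then have "(W j has_real_derivative 0) (at_left y)"
    using has_field_derivative_cong_eventually[of "W j" "\<lambda>_. 0" y "{..<y}" 0] zero[of y] by simp
  ultimately show ?case
    by (rule has_field_derivative_unique) simp
qed

text \<open>The derivative of \<open>y ^ k * W y\<close> integrates to 0. For \<open>k = 0\<close>
  the truncated \<open>k - 1\<close> is harmless, as its term carries the factor
  \<open>real k\<close>.\<close>

lemma power_moment_Suc:
  fixes W W' :: "real \<Rightarrow> real"
  assumes "\<And>y. (W has_real_derivative W' y) (at y)"
    and int: "integrable lborel (\<lambda>y. y ^ k * W y)" "integrable lborel (\<lambda>y. y ^ (k - 1) * W y)"
      "integrable lborel (\<lambda>y. y ^ k * W' y)"
  shows "(\<integral>y. y ^ k * W' y \<partial>lborel) = - real k * (\<integral>y. y ^ (k - 1) * W y \<partial>lborel)"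
proof -
  have "(\<integral>y. real k * (y ^ (k - 1) * W y) + y ^ k * W' y \<partial>lborel) = 0"
  proof (rule integral_derivative_eq_0[OF _ int(1)])
    show "((\<lambda>y. y ^ k * W y) has_real_derivative real k * (y ^ (k - 1) * W y) + y ^ k * W' y) (at y)" for y
      using assms(1) by (auto intro!: derivative_eq_intros)
  qed (use int in auto)
  then show ?thesis using int by simp
qed

text \<open>Each partial integration lowers the power and the order of the derivative by one. For
  \<open>k < j\<close> the power reaches 0 first and the factor 0 appears; for \<open>k = j\<close>
  the factors multiply to a signed factorial.\<close>

lemma power_moments_triangular:
  fixes W :: "nat \<Rightarrow> real \<Rightarrow> real"
  assumes W: "\<And>j y. Suc j < n \<Longrightarrow> (W j has_real_derivative W (Suc j) y) (at y)"
    and int: "\<And>j k. j < n \<Longrightarrow> k < n \<Longrightarrow> integrable lborel (\<lambda>y. y ^ k * W j y)"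
  shows "k < j \<Longrightarrow> j < n \<Longrightarrow> (\<integral>y. y ^ k * W j y \<partial>lborel) = 0"
    and "j < n \<Longrightarrow> (\<integral>y. y ^ j * W j y \<partial>lborel) = (-1) ^ j * fact j * (\<integral>y. W 0 y \<partial>lborel)"
proof -
  have step: "(\<integral>y. y ^ k * W (Suc j) y \<partial>lborel) = - real k * (\<integral>y. y ^ (k - 1) * W j y \<partial>lborel)"
    if "Suc j < n" "k < n" for j k
    using that by (intro power_moment_Suc W int) auto
  show "(\<integral>y. y ^ k * W j y \<partial>lborel) = 0" if "k < j" "j < n"
    using that
  proof (induction j arbitrary: k)
    case (Suc j)
    have "(\<integral>y. y ^ k * W (Suc j) y \<partial>lborel) = - real k * (\<integral>y. y ^ (k - 1) * W j y \<partial>lborel)"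
      by (rule step) (use Suc.prems in auto)
    then show ?case
      using Suc.IH[of "k - 1"] Suc.prems by (cases k) auto
  qed simp
  show "(\<integral>y. y ^ j * W j y \<partial>lborel) = (-1) ^ j * fact j * (\<integral>y. W 0 y \<partial>lborel)" if "j < n"
    using that
  proof (induction j)
    case (Suc j)
    have "(\<integral>y. y ^ Suc j * W (Suc j) y \<partial>lborel) = - real (Suc j) * (\<integral>y. y ^ (Suc j - 1) * W j y \<partial>lborel)"
      by (rule step) (use Suc.prems in auto)
    with Suc show ?case by (simp add: algebra_simps)
  qed simp
qed

text \<open>The moment formula with exponent \<open>\<nu> + 1 + s\<close> and index
  \<open>\<nu> + 1\<close>, whose difference is \<open>s\<close>: the mixture multiplies the moment
  of order \<open>s\<close> by a Gamma value and by \<open>k\<close>.\<close>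

lemma exp_transform_powr_moment:
  assumes g: "integrable_pos_supp g" and "\<nu> > -1" "s \<ge> 0" and int: "integrable lborel (\<lambda>y. y powr s * g y)"
    and f: "\<And>x. x > 0 \<Longrightarrow> f x = k * x powr \<nu> * exp_transform (\<nu> + 1) g x"
  shows "has_bochner_integral lborel (\<lambda>x. indicator {0<..} x * (x powr s * f x))
    (k * Gamma (\<nu> + 1 + s) * (\<integral>y. y powr s * g y \<partial>lborel))"
proof -
  have "has_bochner_integral lborel
      (\<lambda>x. k * (indicator {0<..} x * (x powr (\<nu> + 1 + s - 1) * exp_transform (\<nu> + 1) g x)))
      (k * (Gamma (\<nu> + 1 + s) * (\<integral>y. y powr (\<nu> + 1 + s - (\<nu> + 1)) * g y \<partial>lborel)))"
    using assms by (intro has_bochner_integral_mult_right exp_transform_moment) auto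
  also have "(\<lambda>x. k * (indicator {0<..} x * (x powr (\<nu> + 1 + s - 1) * exp_transform (\<nu> + 1) g x)))
      = (\<lambda>x. indicator {0<..} x * (x powr s * f x))"
    by (auto simp: fun_eq_iff indicator_def f powr_add)
  finally show ?thesis by (simp add: mult.assoc)
qed

lemma exp_transform_L1_moments:
  assumes g: "integrable_pos_supp g" and "\<nu> > -1" and int: "\<And>s. 0 \<le> s \<Longrightarrow> s \<le> real n - 1 \<Longrightarrow> integrable lborel (\<lambda>y. y powr s * g y)"
    and f: "\<And>x. x > 0 \<Longrightarrow> f x = k * x powr \<nu> * exp_transform (\<nu> + 1) g x" and "n \<ge> 1"
  shows "f \<in> L1_moments n {0<..}"
proof -
  have *: "integrable lborel (\<lambda>x. indicator {0<..} x * (x powr s * f x))" if "0 \<le> s" "s \<le> real n - 1" for s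
    using exp_transform_powr_moment[OF g \<open>\<nu> > -1\<close> that(1) int[OF that] f] by (simp add: has_bochner_integral_iff)
  have "(\<lambda>x. indicator {0<..} x * (x powr 0 * f x)) = (\<lambda>x. indicator {0<..} x * f x)"
    by (auto simp: fun_eq_iff indicator_def)
  with *[of 0] \<open>n \<ge> 1\<close> have "set_integrable lborel {0<..} f"
    by (simp add: set_integrable_def)
  moreover have "set_integrable lborel {0<..} (\<lambda>x. \<bar>x\<bar> powr (\<kappa> - 1) * \<bar>f x\<bar>)" if "\<kappa> \<in> {1..real n}" for \<kappa>
  proof -
    have "(\<lambda>x. \<bar>indicator {0<..} x * (x powr (\<kappa> - 1) * f x)\<bar>) = (\<lambda>x. indicator {0<..} x * (\<bar>x\<bar> powr (\<kappa> - 1) * \<bar>f x\<bar>))"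
      by (auto simp: fun_eq_iff indicator_def abs_mult)
    with integrable_abs[OF *[of "\<kappa> - 1"]] that show ?thesis
      by (simp add: set_integrable_def)
  qed
  ultimately show ?thesis by (simp add: L1_moments_def)
qed

text \<open>By continuity the integral over the interval from \<open>x0\<close> to
  \<open>x0 + 1\<close> is already positive.\<close>

lemma integral_pos_continuous:
  fixes f :: "real \<Rightarrow> real"
  assumes int: "integrable lborel f" and cont: "continuous_on UNIV f" and nonneg: "\<And>x. 0 \<le> f x" and "f x0 \<noteq> 0"
  shows "0 < (\<integral>x. f x \<partial>lborel)"
proof -
  have set_int: "set_integrable lborel {x0..x0 + 1} f"
    unfolding set_integrable_def using integrable_mult_indicator[OF _ int, of "{x0..x0 + 1}"] by simp
  have cont': "continuous_on {x0..x0 + 1} f"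
    by (rule continuous_on_subset[OF cont]) simp
  have "integral {x0..x0 + 1} f \<noteq> 0"
    using integral_eq_0_iff[OF cont', of] nonneg \<open>f x0 \<noteq> 0\<close> by force
  moreover have "0 \<le> integral {x0..x0 + 1} f"
    using nonneg by (intro integral_nonneg integrable_continuous_interval cont') auto
  ultimately have "0 < integral {x0..x0 + 1} f" by simp
  also have "\<dots> = (\<integral>x. indicator {x0..x0 + 1} x * f x \<partial>lborel)"
    using set_borel_integral_eq_integral(2)[OF set_int] by (simp add: set_lebesgue_integral_def)
  also have "\<dots> \<le> (\<integral>x. f x \<partial>lborel)"
    using set_int int nonneg by (intro integral_mono) (auto simp: set_integrable_def indicator_def)
  finally show ?thesis .
qed

section \<open>Density of the ensemble\<close>

text \<open>Andreief's identity is read from right to left: the determinant of mixtures is an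
  integral of a product of two determinants, and the sign is settled under the integral.\<close>

lemma exp_transform_det_nonneg:
  assumes W: "\<And>j. j < n \<Longrightarrow> integrable_pos_supp (W j)"
    and sgn: "\<And>y. 0 \<le> vandermonde n y * fun_det n (\<lambda>j i. (-1) ^ j * W j (y i))"
    and "\<nu> > -1" "k \<ge> 0" and a: "\<And>i. i < n \<Longrightarrow> a i > 0"
  shows "0 \<le> vandermonde n a * fun_det n (\<lambda>j i. (-1) ^ j * k * a i powr \<nu> * exp_transform (\<nu> + 1) (W j) (a i))"
proof -
  define f where "f i y = indicator {0<..} y * (k * a i powr \<nu>) * (y powr (- (\<nu> + 1)) * exp (- (a i / y)))" for i y
  define g where "g j y = (-1) ^ j * W j y" for j y
  have zero: "g j y = 0" if "j < n" "y \<le> 0" for j y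
    using W[OF that(1)] that(2) by (simp add: g_def integrable_pos_supp_def)
  have fg: "f i y * g j y = (-1) ^ j * k * a i powr \<nu> * (exp (- (a i / y)) * y powr (- (\<nu> + 1)) * W j y)"
    if "j < n" for i j y
  proof (cases "y > 0")
    case True
    then show ?thesis by (simp add: f_def g_def mult_ac)
  next
    case False
    then show ?thesis
      using W[OF that] by (simp add: g_def integrable_pos_supp_def)
  qed
  have int: "integrable lborel (\<lambda>y. f i y * g j y)" if "i < n" "j < n" for i j
    unfolding fg[OF that(2)] using W a that \<open>\<nu> > -1\<close>
    by (intro integrable_mult_right exp_transform_integrable) auto
  have eq: "fun_det n (\<lambda>j i. (-1) ^ j * k * a i powr \<nu> * exp_transform (\<nu> + 1) (W j) (a i))
      = fun_det n (\<lambda>i j. \<integral>y. f i y * g j y \<partial>lborel)"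
    unfolding fun_det_transpose[of n "\<lambda>i j. \<integral>y. f i y * g j y \<partial>lborel", symmetric]
    by (rule fun_det_cong) (simp add: fg exp_transform_def)
  \<comment> \<open>For distinct positive \<open>y l\<close> the squared Vandermonde product of
    \<open>y\<close> is inserted and later divided out. Otherwise the second determinant has a zero
    column or two equal columns.\<close>
  have pointwise: "0 \<le> vandermonde n a * (fun_det n (\<lambda>i l. f i (y l)) * fun_det n (\<lambda>j l. g j (y l)))" for y
  proof (cases "(\<forall>l<n. y l > 0) \<and> inj_on y {..<n}")
    case True
    have "0 \<le> (\<Prod>i<n. k * a i powr \<nu>) * (\<Prod>l<n. y l powr (- (\<nu> + 1))) *
        ((vandermonde n a * vandermonde n y * fun_det n (\<lambda>i l. exp (- (a i / y l)))) *
         (vandermonde n y * fun_det n (\<lambda>j l. g j (y l))))"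
      using True fun_det_exp_inverse_nonneg[of n y a] sgn[of y] \<open>k \<ge> 0\<close>
      by (intro mult_nonneg_nonneg[OF mult_nonneg_nonneg[OF prod_nonneg prod_nonneg] mult_nonneg_nonneg])
        (auto simp: g_def)
    also have "\<dots> = (vandermonde n y)\<^sup>2 * (vandermonde n a *
        (((\<Prod>i<n. k * a i powr \<nu>) * (\<Prod>l<n. y l powr (- (\<nu> + 1))) * fun_det n (\<lambda>i l. exp (- (a i / y l))))
          * fun_det n (\<lambda>j l. g j (y l))))"
      by (simp only: power2_eq_square mult_ac)
    also have "(\<Prod>i<n. k * a i powr \<nu>) * (\<Prod>l<n. y l powr (- (\<nu> + 1))) * fun_det n (\<lambda>i l. exp (- (a i / y l)))
        = fun_det n (\<lambda>i l. (k * a i powr \<nu>) * y l powr (- (\<nu> + 1)) * exp (- (a i / y l)))"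
      by (rule fun_det_scale[symmetric])
    also have "\<dots> = fun_det n (\<lambda>i l. f i (y l))"
      using True by (intro fun_det_cong) (simp add: f_def)
    finally show ?thesis
      using True vandermonde_eq_0_iff[of n y] by (simp add: zero_le_mult_iff)
  next
    case False
    have "fun_det n (\<lambda>j l. g j (y l)) = 0"
    proof (cases "inj_on y {..<n}")
      case True
      with False obtain l where l: "l < n" "y l \<le> 0" by force
      have "fun_det n (\<lambda>j i. g j (y i)) = fun_det n (\<lambda>j i. (if i = l then 0 else 1) * g j (y i))"
        by (rule fun_det_cong) (auto simp: zero l)
      also have "\<dots> = (\<Prod>i<n. if i = l then 0 else 1) * fun_det n (\<lambda>j i. g j (y i))"
        by (rule fun_det_scale_cols)
      also have "(\<Prod>i<n. if i = l then 0 else 1) = (0::real)"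
        using l by (subst prod_zero_iff) auto
      finally show ?thesis by simp
    next
      case False
      then obtain i l where "i < n" "l < n" "i \<noteq> l" "y i = y l" by (auto simp: inj_on_def)
      then show ?thesis by (intro fun_det_eq_0_if_cols_eq[of i _ l]) auto
    qed
    then show ?thesis by simp
  qed
  have total: "has_bochner_integral (\<Pi>\<^sub>M i\<in>{..<n}. lborel)
      (\<lambda>y. vandermonde n a * (fun_det n (\<lambda>i l. f i (y l)) * fun_det n (\<lambda>j l. g j (y l))))
      (vandermonde n a * (fact n * fun_det n (\<lambda>i j. \<integral>y. f i y * g j y \<partial>lborel)))"
    by (intro has_bochner_integral_mult_right andreief int)
  have "0 \<le> vandermonde n a * (fact n * fun_det n (\<lambda>i j. \<integral>y. f i y * g j y \<partial>lborel))"
    unfolding has_bochner_integral_integral_eq[OF total, symmetric]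
    by (rule Bochner_Integration.integral_nonneg) (rule pointwise)
  also have "\<dots> = fact n * (vandermonde n a * fun_det n (\<lambda>i j. \<integral>y. f i y * g j y \<partial>lborel))"
    by (simp only: mult_ac)
  finally have "0 \<le> vandermonde n a * fun_det n (\<lambda>i j. \<integral>y. f i y * g j y \<partial>lborel)"
    by (simp only: zero_le_mult_iff fact_gt_zero) (use fact_gt_zero[of n, where ?'a = real] in linarith)
  then show ?thesis unfolding eq .
qed

text \<open>The Vandermonde product is the determinant of the powers \<open>a i ^ j\<close>, so
  Andreief's identity turns the total mass into n! times the determinant of a triangular moment
  matrix.\<close>

lemma exp_transform_det_integral:
  assumes W: "\<And>j. j < n \<Longrightarrow> integrable_pos_supp (W j)"
      "\<And>j y. Suc j < n \<Longrightarrow> (W j has_real_derivative W (Suc j) y) (at y)"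
    and int: "\<And>i j. i < n \<Longrightarrow> j < n \<Longrightarrow> integrable lborel (\<lambda>y. y ^ i * W j y)"
    and \<Omega>: "\<And>j x. j < n \<Longrightarrow> x > 0 \<Longrightarrow> \<Omega> j x = (-1) ^ j * k * x powr \<nu> * exp_transform (\<nu> + 1) (W j) x"
    and "\<nu> > -1" "k > 0" and pos: "(\<integral>y. W 0 y \<partial>lborel) > 0"
  shows "\<exists>Z>0. has_bochner_integral (\<Pi>\<^sub>M i\<in>{..<n}. lborel)
    (\<lambda>a. indicator ({..<n} \<rightarrow>\<^sub>E {0<..}) a * (vandermonde n a * fun_det n (\<lambda>j i. \<Omega> j (a i)))) Z"
proof -
  define f :: "nat \<Rightarrow> real \<Rightarrow> real" where "f i x = indicator {0<..} x * x ^ i" for i x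
  define g where "g j x = indicator {0<..} x * \<Omega> j x" for j x
  define V where "V i j = (\<integral>y. y ^ i * W j y \<partial>lborel)" for i j
  have powr: "y powr real i * W j y = y ^ i * W j y" if "j < n" for i j y
    using W(1)[OF that] by (cases "y > 0") (auto simp: powr_realpow integrable_pos_supp_def)
  have fg: "has_bochner_integral lborel (\<lambda>x. f i x * g j x) ((-1) ^ j * k * Gamma (\<nu> + 1 + real i) * V i j)"
    if "i < n" "j < n" for i j
  proof -
    have "has_bochner_integral lborel (\<lambda>x. indicator {0<..} x * (x powr real i * \<Omega> j x))
        ((-1) ^ j * k * Gamma (\<nu> + 1 + real i) * (\<integral>y. y powr real i * W j y \<partial>lborel))"
      using that W(1)[OF that(2)] int[OF that] \<Omega> \<open>\<nu> > -1\<close>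
      by (intro exp_transform_powr_moment) (auto simp: powr)
    also have "(\<lambda>x. indicator {0<..} x * (x powr real i * \<Omega> j x)) = (\<lambda>x. f i x * g j x)"
      by (auto simp: fun_eq_iff f_def g_def indicator_def powr_realpow)
    finally show ?thesis by (simp add: powr that V_def)
  qed
  \<comment> \<open>The factor (-1)^i of the weight cancels the sign of the moment
    \<open>V i i\<close>, so every diagonal entry is positive.\<close>
  define Z where "Z = fact n * (\<Prod>i<n. (-1) ^ i * k * Gamma (\<nu> + 1 + real i) * V i i)"
  have "(-1) ^ i * k * Gamma (\<nu> + 1 + real i) * V i i > 0" if "i < n" for i
  proof -
    have "V i i = (-1) ^ i * fact i * V 0 0"
      using power_moments_triangular(2)[of n W, OF W(2) int that] by (simp add: V_def)
    then have "(-1) ^ i * k * Gamma (\<nu> + 1 + real i) * V i i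
        = ((-1) ^ i * (-1) ^ i) * (k * Gamma (\<nu> + 1 + real i) * fact i * V 0 0)"
      by (simp only: mult_ac)
    also have "\<dots> = k * Gamma (\<nu> + 1 + real i) * fact i * V 0 0"
      by (simp flip: power_mult_distrib)
    also have "\<dots> > 0"
      using pos \<open>k > 0\<close> \<open>\<nu> > -1\<close> by (intro mult_pos_pos Gamma_real_pos) (auto simp: V_def)
    finally show ?thesis .
  qed
  then have "Z > 0"
    unfolding Z_def by (intro mult_pos_pos[OF fact_gt_zero prod_pos]) auto
  have "has_bochner_integral (\<Pi>\<^sub>M i\<in>{..<n}. lborel)
      (\<lambda>a. fun_det n (\<lambda>i l. f i (a l)) * fun_det n (\<lambda>j l. g j (a l)))
      (fact n * fun_det n (\<lambda>i j. \<integral>x. f i x * g j x \<partial>lborel))"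
    using fg by (intro andreief) (auto simp: has_bochner_integral_iff)
  also have "fun_det n (\<lambda>i j. \<integral>x. f i x * g j x \<partial>lborel)
      = fun_det n (\<lambda>i j. (-1) ^ j * k * Gamma (\<nu> + 1 + real i) * V i j)"
    using fg by (intro fun_det_cong has_bochner_integral_integral_eq)
  also have "\<dots> = (\<Prod>i<n. (-1) ^ i * k * Gamma (\<nu> + 1 + real i) * V i i)"
    using power_moments_triangular(1)[of n W, OF W(2) int] by (intro fun_det_lower) (simp add: V_def)
  finally have *: "has_bochner_integral (\<Pi>\<^sub>M i\<in>{..<n}. lborel)
      (\<lambda>a. fun_det n (\<lambda>i l. f i (a l)) * fun_det n (\<lambda>j l. g j (a l))) Z"
    by (simp add: Z_def)
  have "has_bochner_integral (\<Pi>\<^sub>M i\<in>{..<n}. lborel)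
      (\<lambda>a. indicator ({..<n} \<rightarrow>\<^sub>E {0<..}) a * (vandermonde n a * fun_det n (\<lambda>j i. \<Omega> j (a i)))) Z"
  proof (rule has_bochner_integral_cong[THEN iffD1, OF refl _ refl *])
    fix a :: "nat \<Rightarrow> real" assume "a \<in> space (\<Pi>\<^sub>M i\<in>{..<n}. lborel)"
    then have ext: "a \<in> extensional {..<n}" by (auto simp: space_PiM PiE_def)
    \<comment> \<open>Both determinants yield the factor \<open>I\<close>, which is idempotent. On
      extensional points it is the indicator of the positive orthant.\<close>
    define I where "I = (\<Prod>l<n. indicator {0<..} (a l) :: real)"
    have I: "I = indicator ({..<n} \<rightarrow>\<^sub>E {0<..}) a"
    proof (cases "\<forall>l<n. a l > 0")
      case True
      then show ?thesis using ext by (auto simp: I_def PiE_def)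
    next
      case False
      then obtain l where "l < n" "\<not> a l > 0" by blast
      then have "I = 0"
        unfolding I_def by (subst prod_zero_iff) (auto intro!: bexI[of _ l])
      then show ?thesis using False by (auto simp: indicator_def PiE_def)
    qed
    have "fun_det n (\<lambda>i l. f i (a l)) = I * fun_det n (\<lambda>i l. a l ^ i)"
      unfolding f_def I_def by (rule fun_det_scale_cols)
    also have "fun_det n (\<lambda>i l. a l ^ i) = vandermonde n a"
      unfolding vandermonde_eq_fun_det by (rule fun_det_transpose)
    finally have f_det: "fun_det n (\<lambda>i l. f i (a l)) = I * vandermonde n a" .
    have g_det: "fun_det n (\<lambda>j l. g j (a l)) = I * fun_det n (\<lambda>j l. \<Omega> j (a l))"
      unfolding g_def I_def by (rule fun_det_scale_cols)
    have "I * I = I"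
      by (simp add: I indicator_def)
    moreover have "fun_det n (\<lambda>i l. f i (a l)) * fun_det n (\<lambda>j l. g j (a l))
        = (I * I) * (vandermonde n a * fun_det n (\<lambda>j i. \<Omega> j (a i)))"
      unfolding f_det g_det by (simp only: mult_ac)
    ultimately show "fun_det n (\<lambda>i l. f i (a l)) * fun_det n (\<lambda>j l. g j (a l))
        = indicator ({..<n} \<rightarrow>\<^sub>E {0<..}) a * (vandermonde n a * fun_det n (\<lambda>j i. \<Omega> j (a i)))"
      by (simp only: I)
  qed
  with \<open>Z > 0\<close> show ?thesis by blast
qed

theorem theorem2p10:
  fixes n :: nat and M :: matrix_space and \<nu> :: real and w \<omega> :: "real \<Rightarrow> real"
  assumes "n \<ge> 2"
    and "\<nu> = space_param M"
    and "w \<in> L1_H2 n"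
    and "polya_frequency_function n w"
    and "w \<noteq> (\<lambda>_. 0)"
    and "closure {x. w x \<noteq> 0} \<subseteq> {0..}"
    and "\<And>x. x > 0 \<Longrightarrow>
      \<omega> x = 1 / Gamma (\<nu> + 1) * (LBINT y:{0<..}. (x / y) powr \<nu> * exp (- (x / y)) * w y / y)"
  shows "\<omega> \<in> L1_M n M \<and> gives_rise_to_polya_ensemble n M \<omega>"
proof -
  define W where "W j = (deriv ^^ j) w" for j
  define k where "k = 1 / Gamma (\<nu> + 1)"
  have \<nu>: "\<nu> > -1"
    unfolding \<open>\<nu> = space_param M\<close> by (cases M) auto
  have k: "k > 0"
    unfolding k_def using \<nu> by (intro divide_pos_pos Gamma_real_pos) auto
  have nonneg: "0 \<le> w y" for y
    using assms(3) by (simp add: L1_H2_def)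
  have W_deriv: "(W j has_real_derivative W (Suc j) y) (at y)" if "Suc j < n" for j y
  proof -
    have "W j differentiable (at y)"
      using assms(3) that by (auto simp: L1_H2_def times_differentiable_on_def differentiable_on_def W_def)
    then show ?thesis
      by (simp add: W_def DERIV_deriv_iff_real_differentiable)
  qed
  have W0: "W 0 y = 0" if "y \<le> 0" for y
  proof -
    have neg: "w t = 0" if "t < 0" for t
      using that assms(6) closure_subset[of "{x. w x \<noteq> 0}"] by force
    \<comment> \<open>The support condition leaves the value at 0 open; it is 0 by continuity, as
      \<open>w\<close> is differentiable for n >= 2.\<close>
    have "(w \<longlongrightarrow> w 0) (at_left 0)"
      using DERIV_isCont[OF W_deriv[of 0 0]] \<open>n \<ge> 2\<close>
      by (simp add: W_def isCont_def filterlim_at_split)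
    moreover have "eventually (\<lambda>t. w t = 0) (at_left (0::real))"
      by (rule eventually_at_leftI[of "-1"]) (auto intro: neg)
    then have "(w \<longlongrightarrow> 0) (at_left 0)" by (rule tendsto_eventually)
    ultimately have "w 0 = 0"
      by (rule tendsto_unique[OF trivial_limit_at_left_real])
    with neg that show ?thesis by (cases "y = 0") (auto simp: W_def)
  qed
  have W_zero: "W j y = 0" if "j < n" "y \<le> 0" for j y
    using derivatives_vanish[of n W j y] W_deriv W0 that by blast
  have L1: "W j \<in> L1_moments n UNIV" if "j < n" for j
    using assms(3) that by (simp add: L1_H2_def W_def)
  have supp: "integrable_pos_supp (W j)" if "j < n" for j
    using L1[OF that] W_zero[OF that] by (simp add: integrable_pos_supp_def L1_moments_def set_integrable_def)
  have powr_int: "integrable lborel (\<lambda>y. y powr s * W j y)" if "j < n" "0 \<le> s" "s \<le> real n - 1" for j s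
  proof (rule Bochner_Integration.integrable_bound)
    have "\<forall>\<kappa>\<in>{1..real n}. set_integrable lborel UNIV (\<lambda>x. \<bar>x\<bar> powr (\<kappa> - 1) * \<bar>W j x\<bar>)"
      using L1[OF that(1)] by (simp add: L1_moments_def)
    from bspec[OF this, of "s + 1"] that
    have "set_integrable lborel UNIV (\<lambda>x. \<bar>x\<bar> powr s * \<bar>W j x\<bar>)"
      by simp
    then show "integrable lborel (\<lambda>x. \<bar>x\<bar> powr s * \<bar>W j x\<bar>)"
      by (simp add: set_integrable_def)
    have [measurable]: "W j \<in> borel_measurable borel"
      using supp[OF that(1)] by (auto simp: integrable_pos_supp_def)
    show "(\<lambda>y. y powr s * W j y) \<in> borel_measurable lborel" by simp
    have "\<bar>y powr s * W j y\<bar> \<le> \<bar>\<bar>y\<bar> powr s * \<bar>W j y\<bar>\<bar>" for y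
      using W_zero[OF that(1), of y] by (cases "y \<le> 0") (auto simp: abs_mult)
    then show "AE y in lborel. norm (y powr s * W j y) \<le> norm (\<bar>y\<bar> powr s * \<bar>W j y\<bar>)"
      by simp
  qed
  have pow_int: "integrable lborel (\<lambda>y. y ^ i * W j y)" if "i < n" "j < n" for i j
  proof -
    \<comment> \<open>At the origin \<open>0 powr 0 = 0\<close> differs from
      \<open>0 ^ 0 = 1\<close>; the zero of \<open>W j\<close> there hides this.\<close>
    have "(\<lambda>y. y powr real i * W j y) = (\<lambda>y. y ^ i * W j y)"
    proof
      fix y show "y powr real i * W j y = y ^ i * W j y"
        using W_zero[OF that(2), of y] by (cases "y \<le> 0") (auto simp: powr_realpow)
    qed
    then show ?thesis using powr_int[OF that(2), of "real i"] that by simp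
  qed
  have \<omega>: "\<omega> x = k * x powr \<nu> * exp_transform (\<nu> + 1) (W 0) x" if "x > 0" for x
  proof -
    \<comment> \<open>The factor (x/y)^\<nu> / y splits into x^\<nu> and y^(-\<nu>-1), which gives a
      transform of index \<open>\<nu> + 1\<close>.\<close>
    have "indicator {0<..} y *\<^sub>R ((x / y) powr \<nu> * exp (- (x / y)) * w y / y)
        = x powr \<nu> * (exp (- (x / y)) * y powr (- (\<nu> + 1)) * W 0 y)" for y
    proof (cases "y > 0")
      case True
      then show ?thesis
        using that powr_minus_add_one[OF True, of \<nu>] by (simp add: powr_divide powr_minus_divide W_def)
    next
      case False
      then show ?thesis using W0[of y] by simp
    qed
    then show ?thesis
      using assms(7)[OF that] by (simp add: k_def set_lebesgue_integral_def exp_transform_def)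
  qed
  have weight: "(weight_op \<nu> ^^ j) \<omega> x = (-1) ^ j * k * x powr \<nu> * exp_transform (\<nu> + 1) (W j) x"
    if "j < n" "x > 0" for j x
    using weight_op_exp_transform[OF _ _ _ \<nu>] supp W_deriv \<omega> that
    by (rule iterate_exp_transform)
  have bdry: "((\<lambda>g. deriv (bdry_op \<nu> g)) ^^ j) \<omega> x = (-1) ^ j * k * x powr \<nu> * exp_transform (\<nu> + 1) (W j) x"
    if "j < n" "x > 0" for j x
    using bdry_op_exp_transform_DERIV[OF _ _ _ \<nu>] supp W_deriv \<omega> that
    by (rule iterate_exp_transform)
  have n: "0 < n" using \<open>n \<ge> 2\<close> by simp
  have moments: "(weight_op \<nu> ^^ j) \<omega> \<in> L1_moments n {0<..}" if "j < n" for j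
    using supp[OF that] \<nu> powr_int[OF that] weight[OF that]
    by (rule exp_transform_L1_moments) (use n in auto)
  have \<omega>_nonneg: "0 \<le> \<omega> x" if "x > 0" for x
    unfolding \<omega>[OF that] exp_transform_def using k nonneg
    by (intro mult_nonneg_nonneg Bochner_Integration.integral_nonneg) (auto simp: W_def)
  have boundary: "(bdry_op \<nu> (((\<lambda>g. deriv (bdry_op \<nu> g)) ^^ l) \<omega>) \<longlongrightarrow> 0) (at_right 0)" if "l < n - 1" for l
  proof -
    have l: "l < n" "Suc l < n" using that by auto
    \<comment> \<open>Because \<open>Suc l < n\<close>, the next derivative still exists and
      vanishes at 0, as the boundary limit requires.\<close>
    have "(W l has_real_derivative 0) (at 0)"
      using W_deriv[OF l(2), of 0] W_zero[OF l(2), of 0] by simp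
    from exp_transform_boundary[OF supp[OF l(1)] this, of "\<nu> + 1"] \<nu>
    have "((\<lambda>x. - ((-1) ^ l * k) * (x powr (\<nu> + 1) * exp_transform (\<nu> + 2) (W l) x)) \<longlongrightarrow> - ((-1) ^ l * k) * 0) (at_right 0)"
      by (intro tendsto_mult tendsto_const) (simp add: add.assoc)
    moreover have "eventually (\<lambda>x. - ((-1) ^ l * k) * (x powr (\<nu> + 1) * exp_transform (\<nu> + 2) (W l) x)
        = bdry_op \<nu> (((\<lambda>g. deriv (bdry_op \<nu> g)) ^^ l) \<omega>) x) (at_right 0)"
      using eventually_at_right_less[of "0::real"]
    proof eventually_elim
      case (elim x)
      show ?case
        using bdry_op_exp_transform[OF supp[OF l(1)] \<nu> elim bdry[OF l(1)]] by simp
    qed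
    ultimately show ?thesis
      by (simp add: Lim_transform_eventually)
  qed
  have "\<omega> \<in> L1_M n M"
    unfolding L1_M_def Let_def \<open>\<nu> = space_param M\<close>[symmetric]
    using moments moments[OF n] \<omega>_nonneg boundary
      exp_transform_times_differentiable[OF supp[OF n] _ \<omega>, of "2 * (n - 1)"] \<nu>
    by (auto simp: L1_moments_def[of n "{0<..}"])
  moreover have "gives_rise_to_polya_ensemble n M \<omega>"
  proof -
    obtain x0 where "w x0 \<noteq> 0" using assms(5) by blast
    have "continuous_on UNIV (W 0)"
      using W_deriv[of 0] \<open>n \<ge> 2\<close> by (intro DERIV_continuous_on) (auto intro: has_field_derivative_at_within)
    then have W0_pos: "0 < (\<integral>y. W 0 y \<partial>lborel)"
      using supp[OF n] nonneg \<open>w x0 \<noteq> 0\<close>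
      by (intro integral_pos_continuous[of _ x0]) (auto simp: integrable_pos_supp_def W_def)
    let ?det = "\<lambda>a. fun_det n (\<lambda>j i. (weight_op \<nu> ^^ j) \<omega> (a i))"
    obtain Z where Z: "Z > 0" "has_bochner_integral (\<Pi>\<^sub>M i\<in>{..<n}. lborel)
        (\<lambda>a. indicator ({..<n} \<rightarrow>\<^sub>E {0<..}) a * (vandermonde n a * ?det a)) Z"
      using exp_transform_det_integral[OF supp W_deriv pow_int weight \<nu> k W0_pos] by blast
    have sgn: "0 \<le> vandermonde n y * fun_det n (\<lambda>j i. (-1) ^ j * W j (y i))" for y
      using assms(4) _ W_deriv by (rule polya_frequency_derivatives) (use n in \<open>auto simp: W_def\<close>)
    have "0 \<le> vandermonde n a * ?det a" if "a \<in> {..<n} \<rightarrow>\<^sub>E {0<..}" for a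
    proof -
      have a: "a i > 0" if "i < n" for i using that \<open>a \<in> _\<close> by auto
      have "?det a = fun_det n (\<lambda>j i. (-1) ^ j * k * a i powr \<nu> * exp_transform (\<nu> + 1) (W j) (a i))"
        by (rule fun_det_cong) (simp add: weight a)
      then show ?thesis
        using exp_transform_det_nonneg[OF supp sgn \<nu> less_imp_le[OF k] a] by simp
    qed
    \<comment> \<open>The normalization constant is the reciprocal of the total mass
      \<open>Z\<close>.\<close>
    then have "0 \<le> polya_density n M \<omega> (1 / Z) a" if "a \<in> {..<n} \<rightarrow>\<^sub>E {0<..}" for a
      using that \<open>Z > 0\<close> unfolding polya_density_def \<open>\<nu> = space_param M\<close>[symmetric] mult.assoc
      by (intro mult_nonneg_nonneg[of "1 / Z"]) auto
    moreover have "has_bochner_integral (\<Pi>\<^sub>M i\<in>{..<n}. lborel)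
        (\<lambda>a. indicator ({..<n} \<rightarrow>\<^sub>E {0<..}) a * polya_density n M \<omega> (1 / Z) a) 1"
      using has_bochner_integral_mult_right[OF Z(2), of "1 / Z"] \<open>Z > 0\<close>
      by (simp add: polya_density_def \<open>\<nu> = space_param M\<close>[symmetric] mult_ac)
    ultimately show ?thesis
      unfolding gives_rise_to_polya_ensemble_def using \<open>Z > 0\<close> by (intro exI[of _ "1 / Z"]) auto
  qed
  ultimately show ?thesis ..
qed

end
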